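(* For real $x$, let $B(x) = \sum_{n \leq x} \operatorname{sopfr}(n)$, where the sum runs over all positive integers $n \le x$ and $\operatorname{sopfr}(n)$ is the sum of the prime factors of $n$ counted with multiplicity. Then, as $x \to \infty$, $$B(x) \sim \frac{\pi^2}{12}\, \frac{x^2}{\log x}.$$
   Context: For an integer $n > 1$ with prime factorization $n = \prod_{i=1}^r p_i^{\alpha_i}$ (the $p_i$ distinct primes, $\alpha_i \ge 1$ their multiplicities), $\operatorname{sopfr}(n) = \sum_{i=1}^r \alpha_i p_i$, and $\operatorname{sopfr}(1) = 0$. The notation $F(x) \sim G(x)$ means $\lim_{x \to \infty} F(x)/G(x) = 1$. Here $\log$ is the natural logarithm and $\pi$ is the usual constant $3.14159\ldots$. *)

theory Defs
  imports
    Complex_Main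
    "HOL-Computational_Algebra.Primes"
    "HOL-Library.Landau_Symbols"
begin

(* The sum of the prime factors of n with multiplicity. The set of prime factors is
   empty for n = 1, so sopfr 1 = 0; also sopfr 0 = 0, a junk value that is never used. *)
definition sopfr :: "nat \<Rightarrow> nat" where
  "sopfr n = (\<Sum>p\<in>prime_factors n. multiplicity p n * p)"

definition B :: "real \<Rightarrow> real" where
  "B x = (\<Sum>n | 0 < n \<and> real n \<le> x. real (sopfr n))"

end

theory Submission
  imports
    Defs
    "HOL-Complex_Analysis.Complex_Analysis"
    "HOL-Number_Theory.Prime_Powers"
    "HOL-Real_Asymp.Real_Asymp"
begin

text \<open>
  Writing \<^term>\<open>sopfr n\<close> as the sum of the distinct primes dividing \<open>n\<close> plus the contribution of
  repeated prime factors, the second part is at most \<open>sqrt n * log 2 n\<close> because a repeated prime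
  factor is at most \<open>sqrt n\<close>. The first part, summed over \<open>n \<le> N\<close>, counts each prime \<open>p\<close> with weight
  \<open>p * (N div p)\<close>, so it equals the sum of \<open>S (N div m)\<close> over \<open>m \<le> N\<close>, where \<open>S y\<close> is the sum of the
  primes up to \<open>y\<close>. If \<open>S y\<close> is asymptotic to \<open>y\<^sup>2 / (2 * ln y)\<close>, then the \<open>m\<close>-th summand, divided by
  \<open>N\<^sup>2 / ln N\<close>, tends to \<open>1 / (2 * m\<^sup>2)\<close>, dominated by a multiple of \<open>(1 + ln m) / m\<^sup>2\<close>; Tannery's theorem
  and the value \<open>pi\<^sup>2 / 6\<close> of the sum of the inverse squares give the constant \<open>pi\<^sup>2 / 12\<close>.

  The asymptotics of \<open>S\<close> is the prime number theorem in the form \<open>psi n / n \<longlonglongrightarrow> 1\<close> followed by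
  summation by parts (\<open>chebyshev_psi_asymptotics\<close>, \<open>prime_sum_asymptotics\<close>). Conversely, Moebius
  inversion recovers \<open>S\<close> from the sum in question, so the prime number theorem is the heart of the
  matter. It is proved by the method of Newman, in which the step from analytic properties of zeta to
  the distribution of the primes needs a bounded contour and Cauchy's theorem only:

  \<^item> The function \<open>(s - 1) * zeta s\<close> is continued to the half plane \<open>Re s > 0\<close> by a series whose terms
    are second order Taylor remainders (\<open>pole_free_zeta_holomorphic\<close>). Minus the logarithmic
    derivative of zeta is the Dirichlet series of the von Mangoldt function, and its behaviour near a
    zero or pole, together with \<open>3 + 4 * cos t + cos (2 * t) \<ge> 0\<close>, excludes zeros with \<open>Re s \<ge> 1\<close>
    (\<open>pole_free_zeta_nonzero\<close>).

  \<^item> A Dirichlet series with coefficients \<open>a n / n\<close>, \<open>a\<close> bounded, whose sum extends holomorphically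
    across the line \<open>Re z = 0\<close>, converges at \<open>z = 0\<close> (\<open>newman_tauberian\<close>).

  \<^item> By Chebyshev's bound \<open>psi n \<le> 4 * n\<close> this applies to \<open>a n = (psi n - n) / n\<close>: the continuation is
    obtained from the logarithmic derivative of zeta by summation by parts. Hence the sum of
    \<open>(psi n - n) / n\<^sup>2\<close> converges, which for the monotone function \<open>psi\<close> forces \<open>psi n / n\<close> to tend
    to \<open>1\<close> (\<open>mono_tendsto_of_convergent\<close>).
\<close>

section \<open>The zeta function with its pole removed\<close>

text \<open>
  For \<open>n \<ge> 1\<close> this is \<open>s - 1\<close> times the difference of \<open>n powr (-s)\<close> and the integral of \<open>x powr (-s)\<close> over
  \<open>[n, n + 1]\<close>. As \<open>0 powr z = 0\<close>, the term at \<open>n = 0\<close> is the constant \<open>1\<close>, which is what the integral over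
  \<open>[1, \<infinity>)\<close> contributes; so the terms sum to \<open>(s - 1) * zeta s\<close> with no correction.
\<close>
definition zeta_term :: "nat \<Rightarrow> complex \<Rightarrow> complex" where
  "zeta_term n s = (s - 1) * of_nat n powr (- s) - of_nat n powr (1 - s) + of_nat (Suc n) powr (1 - s)"

definition pole_free_zeta :: "complex \<Rightarrow> complex" where
  "pole_free_zeta s = (\<Sum>n. zeta_term n s)"

lemma norm_of_nat_powr: "n > 0 \<Longrightarrow> norm (of_nat n powr s :: complex) = real n powr Re s"
  by (subst norm_powr_real_powr) auto

lemma zeta_term_at_1: "zeta_term n 1 = (if n = 0 then 1 else 0)"
proof -
  have "1 + complex_of_nat n \<noteq> 0" by (metis of_nat_Suc of_nat_eq_0_iff nat.distinct(1))
  thus ?thesis by (simp add: zeta_term_def)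
qed

lemma holomorphic_of_nat_powr [holomorphic_intros]:
  assumes "f holomorphic_on A"
  shows "(\<lambda>s. of_nat n powr f s :: complex) holomorphic_on A"
  using assms by (cases "n = 0") (auto intro!: holomorphic_intros)

lemma zeta_term_holomorphic [holomorphic_intros]:
  "zeta_term n holomorphic_on A"
  unfolding zeta_term_def by (intro holomorphic_intros)

text \<open>
  The term is the error of the linear Taylor approximation to \<open>x powr (1 - s)\<close> on \<open>[n, n + 1]\<close>, hence is
  controlled by the second derivative \<open>s * (s - 1) * x powr (- s - 1)\<close>. The extra decay by one power of \<open>n\<close>
  is what moves the abscissa of convergence from \<open>1\<close> to \<open>0\<close>.
\<close>
lemma norm_zeta_term_le:
  assumes "n > 0" "Re s > -1"
  shows "norm (zeta_term n s) \<le> norm s * norm (s - 1) * real n powr (- 1 - Re s)"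
proof -
  define f :: "nat \<Rightarrow> complex \<Rightarrow> complex" where
    "f = (\<lambda>i x. if i = 0 then x powr (1 - s) else if i = 1 then (1 - s) * x powr (- s)
          else (1 - s) * (-s) * x powr (- s - 1))"
  let ?S = "closed_segment (of_nat n) (of_nat (Suc n)) :: complex set"
  have S: "\<exists>r. x = of_real r \<and> r \<ge> real n" if "x \<in> ?S" for x
  proof -
    from that obtain u where u: "0 \<le> u" "x = of_real (real n + u)"
      by (auto simp: closed_segment_def scaleR_conv_of_real algebra_simps)
    thus ?thesis by (intro exI[of _ "real n + u"]) auto
  qed
  have "norm (f 0 (of_nat (Suc n)) - (\<Sum>i\<le>1. f i (of_nat n) * (of_nat (Suc n) - of_nat n) ^ i / fact i))
     \<le> (norm s * norm (s - 1) * real n powr (- 1 - Re s)) * norm (of_nat (Suc n) - of_nat n :: complex) ^ (Suc 1) / fact 1"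
  proof (rule complex_Taylor[where S = ?S])
    fix i x assume x: "x \<in> ?S" and i: "i \<le> (1::nat)"
    from S[OF x] assms have nonneg: "x \<notin> \<real>\<^sub>\<le>\<^sub>0" "x \<noteq> 0" by (auto simp: complex_nonpos_Reals_iff)
    show "(f i has_field_derivative f (Suc i) x) (at x within ?S)"
      using i nonneg by (cases i) (auto simp: f_def intro!: derivative_eq_intros)
  next
    fix x assume x: "x \<in> ?S"
    from S[OF x] obtain r where r: "x = of_real r" "r \<ge> real n" by blast
    have "norm (f (Suc 1) x) = norm s * norm (s - 1) * r powr (- 1 - Re s)"
    proof -
      have "norm (complex_of_real r powr (- s - 1)) = r powr (- 1 - Re s)"
        using r assms norm_powr_real_powr[of "of_real r" "- s - 1"]
        by (simp add: minus_diff_commute)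
      thus ?thesis by (simp add: f_def norm_mult norm_minus_commute r(1))
    qed
    also have "\<dots> \<le> norm s * norm (s - 1) * real n powr (- 1 - Re s)"
      using r assms by (intro mult_left_mono powr_mono2') auto
    finally show "norm (f (Suc 1) x) \<le> norm s * norm (s - 1) * real n powr (- 1 - Re s)" .
  qed auto
  also have "f 0 (of_nat (Suc n)) - (\<Sum>i\<le>1. f i (of_nat n) * (of_nat (Suc n) - of_nat n) ^ i / fact i) = zeta_term n s"
    by (simp add: f_def zeta_term_def algebra_simps)
  finally show ?thesis by simp
qed

text \<open>
  Weierstrass's test on a disc of half the distance to the boundary line: there the polynomial factor
  is bounded, and the exponent stays below \<open>-1\<close> by a fixed amount.
\<close>
lemma holomorphic_on_series_powr:
  assumes hol: "\<And>n. u n holomorphic_on {s. Re s > c}"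
    and bound: "\<And>n s. n > 0 \<Longrightarrow> Re s > c \<Longrightarrow> norm (u n s) \<le> C * (1 + norm s)\<^sup>2 * real n powr (c - 1 - Re s)"
    and C: "C \<ge> 0"
  shows "(\<lambda>s. \<Sum>n. u n s) holomorphic_on {s. Re s > c}" (is ?A)
    and "\<And>s. Re s > c \<Longrightarrow> summable (\<lambda>n. u n s)"
proof -
  let ?S = "{s. Re s > c}"
  have opn: "open ?S" by (rule open_halfspace_Re_gt)
  obtain g where g: "\<forall>x \<in> ?S. ((\<lambda>n. u n x) sums g x) \<and> g field_differentiable (at x)"
  proof (rule series_differentiable_comparison_complex[OF opn])
    show "u n field_differentiable at x" if "x \<in> ?S" for n x
      using hol that opn holomorphic_on_imp_differentiable_at by blast
  next
    fix x assume x: "x \<in> ?S"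
    define d where "d = (Re x - c) / 2"
    define h where "h = (\<lambda>n. complex_of_real (C * (1 + (norm x + d))\<^sup>2 * real n powr (c - 1 - (Re x - d))))"
    have d: "d > 0" using x by (simp add: d_def)
    have "summable (\<lambda>n. real n powr (c - 1 - (Re x - d)))"
      using x by (subst summable_real_powr_iff) (simp add: d_def field_simps)
    hence "summable h" unfolding h_def by (intro summable_of_real summable_mult)
    moreover have "range h \<subseteq> \<real>\<^sub>\<ge>\<^sub>0" using C by (auto simp: h_def complex_nonneg_Reals_iff)
    moreover have "\<forall>\<^sub>F n in sequentially. \<forall>y\<in>ball x d \<inter> ?S. cmod (u n y) \<le> cmod (h n)"
      using eventually_gt_at_top[of 0]
    proof eventually_elim
      case (elim n)
      show ?case
      proof
        fix y assume y: "y \<in> ball x d \<inter> ?S"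
        have ny: "norm (y - x) < d" using y by (auto simp: dist_norm norm_minus_commute)
        have 1: "norm y \<le> norm x + d" using ny norm_triangle_ineq2[of y x] by linarith
        have 2: "Re y \<ge> Re x - d" using ny abs_Re_le_cmod[of "y - x"] by simp
        have "norm (u n y) \<le> C * (1 + norm y)\<^sup>2 * real n powr (c - 1 - Re y)"
          using bound elim y by auto
        also have "\<dots> \<le> C * (1 + (norm x + d))\<^sup>2 * real n powr (c - 1 - (Re x - d))"
          using 1 2 d C elim by (intro mult_mono powr_mono power_mono) auto
        also have "\<dots> = norm (h n)" unfolding h_def norm_of_real using C by (simp add: abs_mult)
        finally show "norm (u n y) \<le> norm (h n)" .
      qed
    qed
    ultimately show "\<exists>d h. 0 < d \<and> summable h \<and> range h \<subseteq> \<real>\<^sub>\<ge>\<^sub>0 \<and>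
        (\<forall>\<^sub>F n in sequentially. \<forall>y\<in>ball x d \<inter> ?S. cmod (u n y) \<le> cmod (h n))"
      using d by blast
  qed
  show "summable (\<lambda>n. u n s)" if "Re s > c" for s
    using g that by (auto simp: sums_iff)
  have "g holomorphic_on ?S"
    using g by (auto simp: holomorphic_on_def intro: field_differentiable_at_within)
  moreover have "(\<Sum>n. u n s) = g s" if "s \<in> ?S" for s
    using g that by (auto simp: sums_iff)
  ultimately show ?A using holomorphic_cong by (metis (no_types, lifting))
qed

lemma norm_mult_pred_le: "norm s * norm (s - 1) \<le> (1 + norm (s::complex))\<^sup>2"
proof -
  have "norm (s - 1) \<le> norm s + 1" using norm_triangle_ineq4[of s 1] by simp
  hence "norm s * norm (s - 1) \<le> (1 + norm s) * (1 + norm s)" by (intro mult_mono) auto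
  thus ?thesis by (simp add: power2_eq_square)
qed

lemma pole_free_zeta_holomorphic: "pole_free_zeta holomorphic_on {s. Re s > 0}"
proof -
  have *: "norm (zeta_term n s) \<le> 1 * (1 + norm s)\<^sup>2 * real n powr (0 - 1 - Re s)"
    if "n > 0" "Re s > 0" for n s
  proof -
    have "norm (zeta_term n s) \<le> (norm s * norm (s - 1)) * real n powr (- 1 - Re s)"
      using norm_zeta_term_le[of n s] that by simp
    also have "\<dots> \<le> (1 + norm s)\<^sup>2 * real n powr (- 1 - Re s)"
      by (intro mult_right_mono norm_mult_pred_le) auto
    finally show ?thesis by simp
  qed
  show ?thesis
    unfolding pole_free_zeta_def
    by (rule holomorphic_on_series_powr(1)[OF _ *]) (auto intro: holomorphic_intros)
qed

lemma pole_free_zeta_1: "pole_free_zeta 1 = 1"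
  using sums_If_finite_set[of "{0}" "\<lambda>_. 1::complex"]
  by (simp add: pole_free_zeta_def zeta_term_at_1 sums_iff cong: if_cong)

lemma tendsto_of_nat_powr_0:
  assumes "Re s < 0"
  shows "(\<lambda>n. of_nat (Suc n) powr s :: complex) \<longlonglongrightarrow> 0"
proof (rule tendsto_norm_zero_cancel)
  have "(\<lambda>n. real (Suc n) powr Re s) \<longlonglongrightarrow> 0"
    using assms by real_asymp
  thus "(\<lambda>n. norm (of_nat (Suc n) powr s :: complex)) \<longlonglongrightarrow> 0"
    by (subst norm_of_nat_powr) auto
qed

lemma summable_norm_of_nat_powr:
  assumes "Re s > 1"
  shows "summable (\<lambda>n. norm (of_nat n powr (-s) :: complex))"
proof -
  have "norm (of_nat n powr (-s) :: complex) = real n powr (- Re s)" for n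
    by (cases "n = 0") (simp_all add: norm_of_nat_powr)
  thus ?thesis using assms by (simp add: summable_real_powr_iff)
qed

lemmas summable_of_nat_powr = summable_norm_cancel[OF summable_norm_of_nat_powr]

text \<open>
  The differences of the powers telescope from \<open>0 powr (1 - s) = 0\<close> to their limit \<open>0\<close>, leaving only the
  terms of the zeta series.
\<close>
lemma pole_free_zeta_eq:
  assumes "Re s > 1"
  shows "pole_free_zeta s = (s - 1) * (\<Sum>n. of_nat n powr (- s))"
proof -
  have 1: "(\<lambda>n. (s - 1) * of_nat n powr (- s)) sums ((s - 1) * (\<Sum>n. of_nat n powr (- s)))"
    using summable_of_nat_powr[OF assms] by (intro sums_mult summable_sums)
  have "(\<lambda>n. of_nat n powr (1 - s) :: complex) \<longlonglongrightarrow> 0"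
    by (rule LIMSEQ_imp_Suc, rule tendsto_of_nat_powr_0) (use assms in auto)
  from telescope_sums[OF this]
  have 2: "(\<lambda>n. of_nat (Suc n) powr (1 - s) - of_nat n powr (1 - s) :: complex) sums 0"
    by simp
  have "(\<lambda>n. zeta_term n s) sums ((s - 1) * (\<Sum>n. of_nat n powr (- s)))"
    using sums_add[OF 1 2] by (simp add: zeta_term_def algebra_simps)
  thus ?thesis by (simp add: pole_free_zeta_def sums_iff)
qed

section \<open>The Dirichlet series of the von Mangoldt function\<close>

text \<open>
  Absolute convergence allows the double series over pairs \<open>(d, m)\<close> to be grouped by the product
  \<open>n = d * m\<close>. The index \<open>n = 0\<close> is harmless because its set of divisors is infinite, so that the inner
  sum is \<open>0\<close> by convention.
\<close>
lemma sums_dirichlet_product: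
  fixes f g :: "nat \<Rightarrow> complex"
  assumes f: "summable (\<lambda>n. norm (f n))" "f 0 = 0" and g: "summable (\<lambda>n. norm (g n))" "g 0 = 0"
  shows "(\<lambda>n. \<Sum>d | d dvd n. f d * g (n div d)) sums (suminf f * suminf g)"
proof -
  let ?h = "\<lambda>p. f (fst p) * g (snd p)"
  have fs: "(f has_sum suminf f) UNIV" and gs: "(g has_sum suminf g) UNIV"
    using f g by (auto intro!: norm_summable_imp_has_sum summable_sums dest: summable_norm_cancel)
  have "(\<lambda>p. norm (?h p)) summable_on (UNIV \<times> UNIV)"
  proof (subst Infinite_Sum.abs_summable_on_Sigma_iff, intro conjI ballI)
    fix x
    show "(\<lambda>y. norm (?h (x, y))) summable_on UNIV"
      using g by (simp add: norm_mult summable_on_UNIV_nonneg_real_iff summable_mult)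
  next
    have eq: "(\<Sum>\<^sub>\<infinity>y. norm (?h (x, y))) = norm (f x) * (\<Sum>\<^sub>\<infinity>y. norm (g y))" for x
      by (simp add: norm_mult infsum_cmult_right')
    show "(\<lambda>x. norm (\<Sum>\<^sub>\<infinity>y. norm (?h (x, y)))) summable_on UNIV"
      unfolding eq using f
      by (auto simp: summable_on_UNIV_nonneg_real_iff norm_mult abs_mult intro!: summable_mult2)
  qed
  hence "?h summable_on (UNIV \<times> UNIV)" by (rule abs_summable_summable)
  then obtain S where S: "(?h has_sum S) (UNIV \<times> UNIV)" by (auto simp: summable_on_def)
  have "((\<lambda>d. f d * suminf g) has_sum S) UNIV"
    by (rule has_sum_SigmaD[OF S]) (auto intro!: has_sum_cmult_right gs)
  moreover have "((\<lambda>d. f d * suminf g) has_sum (suminf f * suminf g)) UNIV"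
    by (intro has_sum_cmult_left fs)
  ultimately have S_eq: "S = suminf f * suminf g" using has_sum_unique by blast
  have "n > 0" if "f n \<noteq> 0 \<or> g n \<noteq> 0" for n
    using that f(2) g(2) by (cases n) auto
  hence "(?h has_sum S) ({0<..} \<times> {0<..})"
    by (intro has_sum_cong_neutral[THEN iffD1, OF _ _ _ S]) auto
  also have "?this \<longleftrightarrow> ((\<lambda>(n, d). f d * g (n div d)) has_sum S) (SIGMA n:{0<..}. {d. d dvd n})"
    by (rule has_sum_reindex_bij_witness[where j = "\<lambda>(d, m). (d * m, d)" and i = "\<lambda>(n, d). (d, n div d)"])
       (auto elim!: dvdE)
  finally have "((\<lambda>n. \<Sum>d | d dvd n. f d * g (n div d)) has_sum S) {0<..}"
    by (rule has_sum_SigmaD) (auto intro!: has_sum_finiteI)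
  hence "((\<lambda>n. \<Sum>d | d dvd n. f d * g (n div d)) has_sum S) UNIV"
    by (rule has_sum_cong_neutral[THEN iffD1, rotated -1]) auto
  thus ?thesis using has_sum_imp_sums S_eq by blast
qed

lemma summable_ln_powr:
  assumes "\<sigma> > 1"
  shows "summable (\<lambda>n. ln (real n) * real n powr (-\<sigma>))"
proof (rule summable_comparison_test_bigo)
  define e where "e = (\<sigma> - 1) / 2"
  have e: "e > 0" and se: "\<sigma> = 1 + 2 * e" using assms by (auto simp: e_def field_simps)
  show "summable (\<lambda>n. norm (real n powr (- 1 - e)))"
    using e by (simp add: summable_real_powr_iff)
  show "(\<lambda>n. ln (real n) * real n powr - \<sigma>) \<in> O(\<lambda>n. real n powr (- 1 - e))"
    unfolding se using e by real_asymp
qed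

lemma summable_norm_mangoldt_powr:
  assumes "Re s > 1"
  shows "summable (\<lambda>n. norm (mangoldt n * of_nat n powr (-s) :: complex))"
proof (rule summable_comparison_test'[OF summable_ln_powr[OF assms]])
  fix n :: nat assume "n \<ge> 1"
  hence "mangoldt n * real n powr (-Re s) \<le> ln (real n) * real n powr (-Re s)"
    by (intro mult_right_mono mangoldt_le) auto
  thus "norm (norm (mangoldt n * of_nat n powr (-s) :: complex)) \<le> ln (real n) * real n powr (-Re s)"
    using \<open>n \<ge> 1\<close> by (simp add: norm_mult norm_of_nat_powr mangoldt_nonneg)
qed

definition mangoldt_series :: "complex \<Rightarrow> complex" where
  "mangoldt_series s = (\<Sum>n. mangoldt n * of_nat n powr (-s))"

text \<open>
  The coefficients come from the identity that the von Mangoldt function, summed over the divisors of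
  \<open>n\<close>, gives \<open>ln n\<close>.
\<close>
lemma mangoldt_series_times_zeta:
  assumes "Re s > 1"
  shows "(\<lambda>n. of_real (ln (real n)) * of_nat n powr (-s)) sums
           (mangoldt_series s * (\<Sum>n. of_nat n powr (- s)))"
proof -
  have "(\<lambda>n. \<Sum>d | d dvd n. (mangoldt d * of_nat d powr (-s)) * of_nat (n div d) powr (-s)) sums
          (mangoldt_series s * (\<Sum>n. of_nat n powr (- s)))"
    unfolding mangoldt_series_def
    by (rule sums_dirichlet_product)
       (use assms in \<open>auto intro!: summable_norm_mangoldt_powr summable_norm_of_nat_powr\<close>)
  also have "(\<lambda>n. \<Sum>d | d dvd n. (mangoldt d * of_nat d powr (-s)) * of_nat (n div d) powr (-s)) =
             (\<lambda>n. of_real (ln (real n)) * of_nat n powr (-s) :: complex)"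
  proof
    fix n :: nat
    show "(\<Sum>d | d dvd n. (mangoldt d * of_nat d powr (-s)) * of_nat (n div d) powr (-s)) =
            (of_real (ln (real n)) * of_nat n powr (-s) :: complex)"
    proof (cases "n = 0")
      case False
      have "(mangoldt d * of_nat d powr (-s)) * of_nat (n div d) powr (-s) =
              (mangoldt d :: complex) * of_nat n powr (-s)" if "d dvd n" for d
      proof -
        from that obtain k where k: "n = d * k" by (elim dvdE)
        have "of_nat n powr (-s) = (of_nat d powr (-s) * of_nat k powr (-s) :: complex)"
          unfolding k of_nat_mult by (rule powr_times_real) auto
        thus ?thesis using k False by simp
      qed
      hence "(\<Sum>d | d dvd n. (mangoldt d * of_nat d powr (-s)) * of_nat (n div d) powr (-s)) =
             (\<Sum>d | d dvd n. (mangoldt d :: complex)) * of_nat n powr (-s)"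
        unfolding sum_distrib_right by (intro sum.cong) auto
      thus ?thesis using False by (simp add: mangoldt_sum)
    qed auto
  qed
  finally show ?thesis .
qed

text \<open>
  Termwise differentiation produces the coefficients \<open>- ln n\<close>, which the preceding lemma recognises as
  those of a product. This form of the derivative avoids dividing by zeta before it is known to be
  nonzero.
\<close>
lemma has_field_derivative_zeta_series:
  assumes "Re s > 1"
  shows "((\<lambda>s. \<Sum>n. of_nat n powr (- s) :: complex) has_field_derivative
           (- (mangoldt_series s * (\<Sum>n. of_nat n powr (- s))))) (at s)"
proof -
  let ?S = "{s. Re s > 1}"
  have opn: "open ?S" by (rule open_halfspace_Re_gt)
  have "\<exists>g g'. \<forall>x \<in> ?S. ((\<lambda>n. of_nat n powr (-x) :: complex) sums g x) \<and>
          ((\<lambda>n. - of_real (ln (real n)) * of_nat n powr (-x)) sums g' x) \<and> (g has_field_derivative g' x) (at x)"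
  proof (rule series_and_derivative_comparison_complex[OF opn])
    fix n and x :: complex
    show "((\<lambda>x. of_nat n powr (-x)) has_field_derivative - of_real (ln (real n)) * of_nat n powr (-x)) (at x)"
      using DERIV_chain2[OF has_field_derivative_powr_right DERIV_minus[OF DERIV_ident], of "of_nat n" x UNIV]
      by (cases "n = 0") (simp_all add: Ln_of_nat)
  next
    fix x assume x: "x \<in> ?S"
    define d where "d = (Re x - 1) / 2"
    define h where "h = (\<lambda>n. complex_of_real (real n powr (-(Re x - d))))"
    have d: "d > 0" using x by (simp add: d_def)
    have "summable h" unfolding h_def
      using x by (intro summable_of_real) (simp add: summable_real_powr_iff d_def field_simps)
    moreover have "range h \<subseteq> \<real>\<^sub>\<ge>\<^sub>0" by (auto simp: h_def complex_nonneg_Reals_iff)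
    moreover have "\<forall>\<^sub>F n in sequentially. \<forall>y\<in>ball x d \<inter> ?S. cmod (of_nat n powr (-y)) \<le> cmod (h n)"
      using eventually_gt_at_top[of 0]
    proof eventually_elim
      case (elim n)
      show ?case
      proof
        fix y assume y: "y \<in> ball x d \<inter> ?S"
        have "Re y \<ge> Re x - d"
          using y abs_Re_le_cmod[of "y - x"] by (auto simp: dist_norm norm_minus_commute)
        thus "norm (of_nat n powr (-y) :: complex) \<le> norm (h n)"
          using elim by (simp add: norm_of_nat_powr h_def powr_mono)
      qed
    qed
    ultimately show "\<exists>d h. 0 < d \<and> summable h \<and> range h \<subseteq> \<real>\<^sub>\<ge>\<^sub>0 \<and>
        (\<forall>\<^sub>F n in sequentially. \<forall>y\<in>ball x d \<inter> ?S. cmod (of_nat n powr (-y)) \<le> cmod (h n))"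
      using d by blast
  qed
  then obtain g g' where g: "\<And>x. x \<in> ?S \<Longrightarrow> ((\<lambda>n. of_nat n powr (-x) :: complex) sums g x)"
    "\<And>x. x \<in> ?S \<Longrightarrow> ((\<lambda>n. - of_real (ln (real n)) * of_nat n powr (-x)) sums g' x)"
    "\<And>x. x \<in> ?S \<Longrightarrow> (g has_field_derivative g' x) (at x)" by blast
  have "g' s = - (mangoldt_series s * (\<Sum>n. of_nat n powr (- s)))"
    using sums_unique2[OF g(2)[of s]] sums_minus[OF mangoldt_series_times_zeta[OF assms]] assms by simp
  moreover have "((\<lambda>s. \<Sum>n. of_nat n powr (- s) :: complex) has_field_derivative g' s) (at s)"
  proof (rule has_field_derivative_transform_within_open[OF g(3) opn])
    show "\<And>x. x \<in> ?S \<Longrightarrow> g x = (\<Sum>n. of_nat n powr - x)" using g(1) by (simp add: sums_iff)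
  qed (use assms in auto)
  ultimately show ?thesis by simp
qed

lemma deriv_pole_free_zeta:
  assumes "Re s > 1"
  shows "deriv pole_free_zeta s = pole_free_zeta s * (1 / (s - 1) - mangoldt_series s)"
proof -
  have "s \<noteq> 1" using assms by auto
  have "((\<lambda>s. (s - 1) * (\<Sum>n. of_nat n powr (- s))) has_field_derivative
          (\<Sum>n. of_nat n powr (- s)) + (s - 1) * (- (mangoldt_series s * (\<Sum>n. of_nat n powr (- s))))) (at s)"
    using assms by (auto intro!: derivative_eq_intros has_field_derivative_zeta_series)
  also have "?this \<longleftrightarrow> (pole_free_zeta has_field_derivative
          (\<Sum>n. of_nat n powr (- s)) + (s - 1) * (- (mangoldt_series s * (\<Sum>n. of_nat n powr (- s))))) (at s)"
  proof (rule DERIV_cong_ev)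
    have "\<forall>\<^sub>F x in nhds s. x \<in> {s. Re s > 1}"
      by (intro eventually_nhds_in_open open_halfspace_Re_gt) (use assms in auto)
    thus "\<forall>\<^sub>F x in nhds s. (x - 1) * (\<Sum>n. of_nat n powr - x) = pole_free_zeta x"
      by eventually_elim (simp add: pole_free_zeta_eq)
  qed auto
  finally have "deriv pole_free_zeta s = (\<Sum>n. of_nat n powr (- s)) + (s - 1) * (- (mangoldt_series s * (\<Sum>n. of_nat n powr (- s))))"
    by (rule DERIV_imp_deriv)
  also have "\<dots> = pole_free_zeta s * (1 / (s - 1) - mangoldt_series s)"
    using \<open>s \<noteq> 1\<close> by (simp add: pole_free_zeta_eq[OF assms] field_simps)
  finally show ?thesis .
qed

section \<open>Nonvanishing on the line of real part one\<close>

text \<open>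
  If \<open>f w = g w * (w - a) ^ m\<close> with \<open>g a \<noteq> 0\<close>, then the logarithmic derivative of \<open>f\<close> is
  \<open>m / (w - a) + deriv g w / g w\<close>, so the limit reads off the order \<open>m\<close> of the zero.
\<close>
lemma tendsto_log_deriv:
  assumes holo: "f holomorphic_on S" and S: "open S" "connected S" "a \<in> S" and nz: "\<exists>w\<in>S. f w \<noteq> 0"
  obtains m :: nat where "m = 0 \<longleftrightarrow> f a \<noteq> 0"
    and "((\<lambda>w. (w - a) * (deriv f w / f w)) \<longlongrightarrow> of_nat m) (at a)"
    and "eventually (\<lambda>w. f w \<noteq> 0) (at a)"
proof -
  define m where "m = nat (zorder f a)"
  define g where "g = zor_poly f a"
  note Z = zorder_exist_zero[OF holo S nz, folded m_def g_def]
  have m0: "m = 0 \<longleftrightarrow> f a \<noteq> 0" using Z unfolding m_def by (simp split: if_splits)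
  obtain r where r: "r > 0" "cball a r \<subseteq> S" "g holomorphic_on cball a r"
    and fg: "\<And>w. w \<in> cball a r \<Longrightarrow> f w = g w * (w - a) ^ m" and g0: "\<And>w. w \<in> cball a r \<Longrightarrow> g w \<noteq> 0"
    using conjunct2[OF Z] by blast
  have ev: "eventually (\<lambda>w. w \<in> ball a r - {a}) (at a)"
    using r(1) eventually_at_ball'[of r a UNIV] by simp
  have hg: "g holomorphic_on ball a r" using r(3) holomorphic_on_subset by fastforce
  have "((\<lambda>w. (w - a) * (deriv g w / g w) + of_nat m) \<longlongrightarrow> (a - a) * (deriv g a / g a) + of_nat m) (at a)"
  proof (intro tendsto_intros)
    have "isCont (deriv g) a" "isCont g a"
      using holomorphic_on_imp_continuous_on[OF holomorphic_deriv[OF hg]] holomorphic_on_imp_continuous_on[OF hg] r(1)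
      by (auto simp: continuous_on_eq_continuous_at)
    thus "(deriv g \<longlongrightarrow> deriv g a) (at a)" "(g \<longlongrightarrow> g a) (at a)" by (auto simp: isCont_def)
    show "g a \<noteq> 0" using g0 r(1) by auto
  qed
  moreover have "\<forall>\<^sub>F w in at a. (w - a) * (deriv g w / g w) + of_nat m = (w - a) * (deriv f w / f w)"
    using ev
  proof eventually_elim
    case (elim w)
    have dg: "(g has_field_derivative deriv g w) (at w)"
      using elim hg holomorphic_derivI by blast
    have "((\<lambda>w. g w * (w - a) ^ m) has_field_derivative
             (deriv g w * (w - a) ^ m + (of_nat m * (w - a) ^ (m - 1)) * g w)) (at w)"
      by (auto intro!: derivative_eq_intros dg)
    hence "(f has_field_derivative (deriv g w * (w - a) ^ m + (of_nat m * (w - a) ^ (m - 1)) * g w)) (at w)"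
      by (rule has_field_derivative_transform_within_open[of _ _ _ "ball a r"]) (use elim fg in auto)
    hence "deriv f w = deriv g w * (w - a) ^ m + (of_nat m * (w - a) ^ (m - 1)) * g w"
      by (rule DERIV_imp_deriv)
    hence eq: "(w - a) * deriv f w = (deriv g w * (w - a) + of_nat m * g w) * (w - a) ^ m"
    proof (cases m)
      case (Suc k)
      have "(w - a) * (of_nat m * (w - a) ^ (m - 1) * g w) = of_nat m * g w * (w - a) ^ m"
        unfolding Suc by simp
      thus ?thesis using \<open>deriv f w = _\<close> by (simp only: distrib_left distrib_right mult_ac)
    qed simp
    have fw: "f w = g w * (w - a) ^ m" "g w \<noteq> 0" "(w - a) ^ m \<noteq> 0" using elim fg g0 by auto
    have "(w - a) * (deriv f w / f w) = ((w - a) * deriv f w) / f w" by simp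
    also have "\<dots> = (deriv g w * (w - a) + of_nat m * g w) / g w"
      unfolding eq fw(1) using fw(2,3) by simp
    also have "\<dots> = (w - a) * (deriv g w / g w) + of_nat m"
      using fw(2) by (simp add: add_divide_distrib)
    finally show ?case ..
  qed
  ultimately have "((\<lambda>w. (w - a) * (deriv f w / f w)) \<longlongrightarrow> (a - a) * (deriv g a / g a) + of_nat m) (at a)"
    by (rule Lim_transform_eventually)
  hence "((\<lambda>w. (w - a) * (deriv f w / f w)) \<longlongrightarrow> of_nat m) (at a)"
    by (simp only: diff_self mult_zero_left add_0)
  moreover have "eventually (\<lambda>w. f w \<noteq> 0) (at a)"
    using ev by eventually_elim (use fg g0 in auto)
  ultimately show ?thesis by (rule that[OF m0])
qed

text \<open>
  Approaching \<open>a\<close> horizontally from the right, the von Mangoldt series sees the pole of zeta at \<open>1\<close> with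
  weight \<open>1\<close> and a zero of order \<open>m\<close> at \<open>a\<close> with weight \<open>- m\<close>.
\<close>
lemma tendsto_mangoldt_series:
  assumes "Re a \<ge> 1"
  obtains m :: nat where "m = 0 \<longleftrightarrow> pole_free_zeta a \<noteq> 0"
    and "((\<lambda>\<epsilon>. of_real \<epsilon> * mangoldt_series (a + of_real \<epsilon>)) \<longlongrightarrow>
           (if a = 1 then 1 else 0) - of_nat m) (at_right 0)"
proof -
  let ?S = "{s. Re s > 0}"
  have conn: "connected ?S" by (intro convex_connected convex_halfspace_Re_gt)
  have nz: "\<exists>w\<in>?S. pole_free_zeta w \<noteq> 0"
    by (rule bexI[of _ 1]) (auto simp: pole_free_zeta_1)
  have a: "a \<in> ?S" using assms by simp
  obtain m where m: "m = 0 \<longleftrightarrow> pole_free_zeta a \<noteq> 0"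
    "((\<lambda>w. (w - a) * (deriv pole_free_zeta w / pole_free_zeta w)) \<longlongrightarrow> of_nat m) (at a)"
    "eventually (\<lambda>w. pole_free_zeta w \<noteq> 0) (at a)"
    by (rule tendsto_log_deriv[OF pole_free_zeta_holomorphic open_halfspace_Re_gt conn a nz])
  have lim: "filterlim (\<lambda>\<epsilon>. a + of_real \<epsilon>) (at a) (at_right (0::real))"
    unfolding filterlim_at by (auto intro!: tendsto_eq_intros eventually_at_right_less simp: eventually_at_filter)
  note m2 = filterlim_compose[OF m(2) lim] and m3 = eventually_compose_filterlim[OF m(3) lim]
  have "((\<lambda>\<epsilon>. of_real \<epsilon> / (a - 1 + of_real \<epsilon>)) \<longlongrightarrow> (if a = 1 then 1 else 0)) (at_right (0::real))"
  proof (cases "a = 1")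
    case True
    have "\<forall>\<^sub>F \<epsilon> in at_right (0::real). 1 = (of_real \<epsilon> / (a - 1 + of_real \<epsilon>) :: complex)"
      using eventually_at_right_less[of 0] by eventually_elim (use True in auto)
    from tendsto_eventually[OF eventually_mono[OF this]] show ?thesis using True by auto
  next
    case False
    have "((\<lambda>\<epsilon>. of_real \<epsilon> / (a - 1 + of_real \<epsilon>)) \<longlongrightarrow> of_real 0 / (a - 1 + of_real 0)) (at_right (0::real))"
      using False by (intro tendsto_intros) auto
    thus ?thesis using False by simp
  qed
  from tendsto_diff[OF this m2]
  have "((\<lambda>\<epsilon>. of_real \<epsilon> / (a - 1 + of_real \<epsilon>) - (a + of_real \<epsilon> - a) *
           (deriv pole_free_zeta (a + of_real \<epsilon>) / pole_free_zeta (a + of_real \<epsilon>))) \<longlongrightarrow>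
           (if a = 1 then 1 else 0) - of_nat m) (at_right 0)" .
  moreover have "\<forall>\<^sub>F \<epsilon> in at_right 0. of_real \<epsilon> / (a - 1 + of_real \<epsilon>) - (a + of_real \<epsilon> - a) *
           (deriv pole_free_zeta (a + of_real \<epsilon>) / pole_free_zeta (a + of_real \<epsilon>)) =
           of_real \<epsilon> * mangoldt_series (a + of_real \<epsilon>)"
    using m3 eventually_at_right_less[of 0]
  proof eventually_elim
    case (elim \<epsilon>)
    have "deriv pole_free_zeta (a + of_real \<epsilon>) / pole_free_zeta (a + of_real \<epsilon>) =
          1 / (a + of_real \<epsilon> - 1) - mangoldt_series (a + of_real \<epsilon>)"
      using elim assms by (subst deriv_pole_free_zeta) auto
    show ?case
      by (subst \<open>_ / _ = _\<close>) (simp add: right_diff_distrib algebra_simps)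
  qed
  ultimately have "((\<lambda>\<epsilon>. of_real \<epsilon> * mangoldt_series (a + of_real \<epsilon>)) \<longlongrightarrow>
           (if a = 1 then 1 else 0) - of_nat m) (at_right 0)"
    by (rule Lim_transform_eventually)
  thus ?thesis by (rule that[OF m(1)])
qed

lemma Re_mangoldt_series:
  assumes "\<sigma> > 1"
  shows "(\<lambda>n. mangoldt n * real n powr (-\<sigma>) * cos (t * ln (real n))) sums
           Re (mangoldt_series (of_real \<sigma> + \<i> * of_real t))"
proof -
  let ?s = "of_real \<sigma> + \<i> * of_real t"
  have "(\<lambda>n. mangoldt n * of_nat n powr (-?s)) sums mangoldt_series ?s"
    unfolding mangoldt_series_def
    using summable_norm_cancel[OF summable_norm_mangoldt_powr[of ?s]] assms by (simp add: summable_sums)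
  hence "(\<lambda>n. Re (mangoldt n * of_nat n powr (-?s))) sums Re (mangoldt_series ?s)"
    by (rule sums_Re)
  also have "(\<lambda>n. Re (mangoldt n * of_nat n powr (-?s))) =
               (\<lambda>n. mangoldt n * real n powr (-\<sigma>) * cos (t * ln (real n)))"
  proof
    fix n :: nat
    show "Re (mangoldt n * of_nat n powr (-?s)) = mangoldt n * real n powr (-\<sigma>) * cos (t * ln (real n))"
    proof (cases "n = 0")
      case False
      have "of_nat n powr (-?s) = exp (-?s * of_real (ln (real n)))"
        using False by (simp add: powr_def Ln_of_nat)
      hence "Re (of_nat n powr (-?s)) = real n powr (-\<sigma>) * cos (t * ln (real n))"
        using False by (simp add: Re_exp powr_def)
      thus ?thesis by (simp only: Re_mangoldt Im_mangoldt times_complex.sel)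
    qed auto
  qed
  finally show ?thesis .
qed

text \<open>
  Termwise this is \<open>3 + 4 * cos \<theta> + cos (2 * \<theta>) = 2 * (1 + cos \<theta>)\<^sup>2 \<ge> 0\<close>, applied with \<open>\<theta> = t * ln n\<close>.
\<close>
lemma mangoldt_series_341:
  assumes "\<sigma> > 1"
  shows "3 * Re (mangoldt_series (of_real \<sigma>)) + 4 * Re (mangoldt_series (of_real \<sigma> + \<i> * of_real t))
           + Re (mangoldt_series (of_real \<sigma> + \<i> * of_real (2 * t))) \<ge> 0"
proof -
  let ?L = "\<lambda>t n. mangoldt n * real n powr (-\<sigma>) * cos (t * ln (real n))"
  have S: "(\<lambda>n. 3 * ?L 0 n + 4 * ?L t n + ?L (2 * t) n) sums
     (3 * Re (mangoldt_series (of_real \<sigma> + \<i> * of_real 0)) + 4 * Re (mangoldt_series (of_real \<sigma> + \<i> * of_real t))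
           + Re (mangoldt_series (of_real \<sigma> + \<i> * of_real (2 * t))))"
    by (intro sums_add sums_mult Re_mangoldt_series assms)
  have nonneg: "3 * ?L 0 n + 4 * ?L t n + ?L (2 * t) n \<ge> 0" for n
  proof -
    have cos: "3 + 4 * cos \<theta> + cos (2 * \<theta>) = 2 * (1 + cos \<theta>)\<^sup>2" for \<theta> :: real
      by (simp only: cos_double_cos) (simp add: power2_eq_square algebra_simps)
    have "3 * ?L 0 n + 4 * ?L t n + ?L (2 * t) n =
            mangoldt n * real n powr (-\<sigma>) * (3 + 4 * cos (t * ln (real n)) + cos (2 * (t * ln (real n))))"
      by (simp add: algebra_simps)
    also note cos
    finally show ?thesis by (simp add: mangoldt_nonneg)
  qed
  show ?thesis using sums_le[OF nonneg sums_zero S] by simp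
qed

lemma norm_mangoldt_series_le:
  assumes "Re s \<ge> \<sigma>" "\<sigma> > 1"
  shows "norm (mangoldt_series s) \<le> (\<Sum>n. norm (mangoldt n * of_nat n powr (-of_real \<sigma>) :: complex))"
  unfolding mangoldt_series_def
proof (rule norm_suminf_le)
  fix n :: nat
  show "norm (mangoldt n * of_nat n powr (-s) :: complex) \<le> norm (mangoldt n * of_nat n powr (-of_real \<sigma>) :: complex)"
    using assms by (cases "n = 0") (auto simp: norm_mult norm_of_nat_powr mangoldt_nonneg intro!: mult_left_mono powr_mono)
qed (rule summable_norm_mangoldt_powr, use assms in auto)

text \<open>
  To the right of the line the von Mangoldt series is bounded near \<open>a\<close>, so the order of a zero there
  must be \<open>0\<close>. On the line, let \<open>m\<close> and \<open>k\<close> be the orders at \<open>1 + \<i> t\<close> and \<open>1 + 2 \<i> t\<close>; multiplying the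
  inequality above by \<open>\<epsilon>\<close> and letting \<open>\<epsilon>\<close> tend to \<open>0\<close> gives \<open>3 - 4 * m - k \<ge> 0\<close>, hence \<open>m = 0\<close>.
\<close>
theorem pole_free_zeta_nonzero:
  assumes "Re a \<ge> 1"
  shows "pole_free_zeta a \<noteq> 0"
proof (cases "Re a > 1")
  case True
  obtain m :: nat where m: "m = 0 \<longleftrightarrow> pole_free_zeta a \<noteq> 0"
    "((\<lambda>\<epsilon>. of_real \<epsilon> * mangoldt_series (a + of_real \<epsilon>)) \<longlongrightarrow> (if a = 1 then 1 else 0) - of_nat m) (at_right 0)"
    by (rule tendsto_mangoldt_series[OF assms])
  define C where "C = (\<Sum>n. norm (mangoldt n * of_nat n powr (-of_real (Re a)) :: complex))"
  have "((\<lambda>\<epsilon>. of_real \<epsilon> * mangoldt_series (a + of_real \<epsilon>)) \<longlongrightarrow> 0) (at_right 0)"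
  proof (rule Lim_null_comparison)
    show "\<forall>\<^sub>F \<epsilon> in at_right 0. norm (of_real \<epsilon> * mangoldt_series (a + of_real \<epsilon>)) \<le> \<epsilon> * C"
      using eventually_at_right_less[of 0]
    proof eventually_elim
      case (elim \<epsilon>)
      thus ?case using norm_mangoldt_series_le[of "Re a" "a + of_real \<epsilon>"] True
        by (auto simp: norm_mult C_def intro!: mult_left_mono)
    qed
    show "((\<lambda>\<epsilon>. \<epsilon> * C) \<longlongrightarrow> 0) (at_right 0)" by (auto intro!: tendsto_eq_intros)
  qed
  from tendsto_unique[OF _ this m(2)] True have "m = 0" by (auto split: if_splits)
  thus ?thesis using m by simp
next
  case False
  define t where "t = Im a"
  have a: "a = 1 + \<i> * of_real t" using False assms by (auto simp: complex_eq_iff t_def)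
  show ?thesis
  proof (cases "t = 0")
    case True
    thus ?thesis using a by (simp add: pole_free_zeta_1)
  next
    case False
    define b where "b = 1 + \<i> * of_real (2 * t)"
    have b1: "b \<noteq> 1" "a \<noteq> 1" using False a by (auto simp: b_def complex_eq_iff)
    obtain m :: nat where m: "m = 0 \<longleftrightarrow> pole_free_zeta a \<noteq> 0"
      "((\<lambda>\<epsilon>. of_real \<epsilon> * mangoldt_series (a + of_real \<epsilon>)) \<longlongrightarrow> (if a = 1 then 1 else 0) - of_nat m) (at_right 0)"
      by (rule tendsto_mangoldt_series[OF assms])
    obtain k :: nat where k:
      "((\<lambda>\<epsilon>. of_real \<epsilon> * mangoldt_series (b + of_real \<epsilon>)) \<longlongrightarrow> (if b = 1 then 1 else 0) - of_nat k) (at_right 0)"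
      by (rule tendsto_mangoldt_series[of b]) (simp add: b_def)
    obtain l :: nat where l: "l = 0"
      "((\<lambda>\<epsilon>. of_real \<epsilon> * mangoldt_series (1 + of_real \<epsilon>)) \<longlongrightarrow> (if (1::complex) = 1 then 1 else 0) - of_nat l) (at_right 0)"
    proof -
      obtain l :: nat where l: "l = 0 \<longleftrightarrow> pole_free_zeta 1 \<noteq> 0"
      "((\<lambda>\<epsilon>. of_real \<epsilon> * mangoldt_series (1 + of_real \<epsilon>)) \<longlongrightarrow> (if (1::complex) = 1 then 1 else 0) - of_nat l) (at_right 0)"
        by (rule tendsto_mangoldt_series[of 1]) simp
      thus ?thesis using that pole_free_zeta_1 by simp
    qed
    have "((\<lambda>\<epsilon>. 3 * Re (of_real \<epsilon> * mangoldt_series (1 + of_real \<epsilon>)) +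
             4 * Re (of_real \<epsilon> * mangoldt_series (a + of_real \<epsilon>)) + Re (of_real \<epsilon> * mangoldt_series (b + of_real \<epsilon>)))
             \<longlongrightarrow> 3 * Re (1 - of_nat l) + 4 * Re (0 - of_nat m) + Re (0 - of_nat k)) (at_right 0)"
      using m(2) k l(2) b1 by (intro tendsto_intros) simp_all
    moreover have "\<forall>\<^sub>F \<epsilon> in at_right 0. 3 * Re (of_real \<epsilon> * mangoldt_series (1 + of_real \<epsilon>)) +
             4 * Re (of_real \<epsilon> * mangoldt_series (a + of_real \<epsilon>)) + Re (of_real \<epsilon> * mangoldt_series (b + of_real \<epsilon>)) \<ge> 0"
      using eventually_at_right_less[of 0]
    proof eventually_elim
      case (elim \<epsilon>)
      have "0 \<le> \<epsilon> * (3 * Re (mangoldt_series (of_real (1 + \<epsilon>))) + 4 * Re (mangoldt_series (of_real (1 + \<epsilon>) + \<i> * of_real t))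
           + Re (mangoldt_series (of_real (1 + \<epsilon>) + \<i> * of_real (2 * t))))"
        using mangoldt_series_341[of "1 + \<epsilon>" t] elim by (intro mult_nonneg_nonneg) auto
      also have "\<dots> = 3 * Re (of_real \<epsilon> * mangoldt_series (1 + of_real \<epsilon>)) +
             4 * Re (of_real \<epsilon> * mangoldt_series (a + of_real \<epsilon>)) + Re (of_real \<epsilon> * mangoldt_series (b + of_real \<epsilon>))"
        by (simp add: a b_def algebra_simps)
      finally show ?case .
    qed
    ultimately have "3 * Re (1 - of_nat l) + 4 * Re (0 - of_nat m) + Re (0 - of_nat k) \<ge> 0"
      by (rule tendsto_lowerbound) auto
    hence "4 * m + k \<le> 3" using l(1) by simp
    hence "m = 0" by linarith
    thus ?thesis using m(1) by simp
  qed
qed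

section \<open>A Tauberian theorem of Newman\<close>

lemma powr_diff_mvt:
  fixes x y :: real
  assumes "0 < x"
  obtains \<xi> where "x < \<xi>" "\<xi> < x + 1" "(x + 1) powr y - x powr y = y * \<xi> powr (y - 1)"
proof -
  have "\<exists>z. x < z \<and> z < x + 1 \<and> (x + 1) powr y - x powr y = ((x + 1) - x) * (y * z powr (y - 1))"
    by (rule MVT2[where f = "\<lambda>z. z powr y" and f' = "\<lambda>z. y * z powr (y - 1)"])
       (use assms in \<open>auto intro!: has_real_derivative_powr\<close>)
  thus ?thesis using that by auto
qed

text \<open>
  Comparison with the integral of \<open>t powr (- x - 1)\<close>: by the mean value theorem each term is at most a
  difference of consecutive values of \<open>t powr (- x) / x\<close>.
\<close>
lemma suminf_powr_tail_le:
  assumes "x > 0" "N > 0"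
  shows "summable (\<lambda>n. real (n + Suc N) powr (-x - 1))"
    and "(\<Sum>n. real (n + Suc N) powr (-x - 1)) \<le> real N powr (-x) / x"
proof -
  show s: "summable (\<lambda>n. real (n + Suc N) powr (-x - 1))"
    using assms summable_ignore_initial_segment[of "\<lambda>n. real n powr (-x - 1)" "Suc N"]
    by (simp add: summable_real_powr_iff)
  have lim: "(\<lambda>n. - (real (n + N) powr (-x) / x)) \<longlonglongrightarrow> 0"
    using assms by real_asymp
  have "(\<lambda>n. - (real (Suc n + N) powr (-x) / x) - (- (real (n + N) powr (-x) / x))) sums
          (0 - (- (real (0 + N) powr (-x) / x)))"
    by (rule telescope_sums[OF lim])
  moreover have "real (n + Suc N) powr (-x - 1) \<le> - (real (Suc n + N) powr (-x) / x) - (- (real (n + N) powr (-x) / x))" for n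
  proof -
    obtain \<xi> where xi: "real (n + N) < \<xi>" "\<xi> < real (n + N) + 1"
       "(real (n + N) + 1) powr (-x) - real (n + N) powr (-x) = -x * \<xi> powr (-x - 1)"
      using powr_diff_mvt[of "real (n + N)" "-x"] assms by auto
    have "real (n + Suc N) powr (-x - 1) \<le> \<xi> powr (-x - 1)"
      using xi assms by (intro powr_mono2') auto
    also have "\<dots> = ((real (n + N) powr (-x)) - (real (n + N) + 1) powr (-x)) / x"
      using xi(3) assms by (simp add: field_simps)
    finally show ?thesis using assms by (simp add: diff_divide_distrib add_ac)
  qed
  ultimately show "(\<Sum>n. real (n + Suc N) powr (-x - 1)) \<le> real N powr (-x) / x"
    using sums_le[OF _ summable_sums[OF s]] by fastforce
qed

text \<open>
  Again a comparison with an integral. The summand is increasing for \<open>y \<ge> 1\<close> and decreasing for \<open>y \<le> 1\<close>;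
  the second term on the right is the price of the increasing case.
\<close>
lemma sum_powr_le:
  assumes "y > 0" "N > 0"
  shows "(\<Sum>n=1..N. real n powr (y - 1)) \<le> real N powr y / y + real N powr (y - 1)"
proof (cases "y \<ge> 1")
  case True
  from \<open>N > 0\<close> show ?thesis
  proof (induction N rule: nat_induct_non_zero)
    case 1
    show ?case using assms by simp
  next
    case (Suc N)
    obtain \<xi> where xi: "real N < \<xi>" "\<xi> < real N + 1"
       "(real N + 1) powr y - real N powr y = y * \<xi> powr (y - 1)"
      using powr_diff_mvt[of "real N" y] Suc by auto
    have "real N powr (y - 1) \<le> \<xi> powr (y - 1)"
      using xi True Suc by (intro powr_mono2) auto
    also have "\<dots> = (real (Suc N) powr y - real N powr y) / y"
      using xi(3) assms by (simp add: field_simps)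
    finally show ?case using Suc by (simp add: diff_divide_distrib)
  qed
next
  case False
  from \<open>N > 0\<close> have "(\<Sum>n=1..N. real n powr (y - 1)) \<le> real N powr y / y"
  proof (induction N rule: nat_induct_non_zero)
    case 1
    show ?case using assms False by simp
  next
    case (Suc N)
    obtain \<xi> where xi: "real N < \<xi>" "\<xi> < real N + 1"
       "(real N + 1) powr y - real N powr y = y * \<xi> powr (y - 1)"
      using powr_diff_mvt[of "real N" y] Suc by auto
    have "real (Suc N) powr (y - 1) \<le> \<xi> powr (y - 1)"
      using xi False Suc by (intro powr_mono2') auto
    also have "\<dots> = (real (Suc N) powr y - real N powr y) / y"
      using xi(3) assms by (simp add: field_simps)
    finally show ?case using Suc by (simp add: diff_divide_distrib)
  qed
  moreover have "real N powr (y - 1) \<ge> 0" by simp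
  ultimately show ?thesis by linarith
qed

abbreviation "right_arc R \<equiv> part_circlepath 0 R (-(pi/2)) (pi/2)"
abbreviation "left_arc R \<equiv> part_circlepath 0 R (pi/2) (3*pi/2)"

text \<open>
  Three sides of a rectangle, from \<open>\<i> R\<close> to \<open>- \<i> R\<close> through the left half plane. Closing it up by the right
  half circle gives a contour inside the half strip \<open>Re z \<ge> - \<delta>\<close>, \<open>\<bar>Im z\<bar> \<le> R\<close>. That strip is convex, so
  Cauchy's theorem for convex sets suffices.
\<close>
definition left_box :: "real \<Rightarrow> real \<Rightarrow> real \<Rightarrow> complex" where
  "left_box \<delta> R = linepath (\<i> * of_real R) (\<i> * of_real R - of_real \<delta>) +++
     linepath (\<i> * of_real R - of_real \<delta>) (- \<i> * of_real R - of_real \<delta>) +++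
     linepath (- \<i> * of_real R - of_real \<delta>) (- \<i> * of_real R)"

lemma valid_path_left_box [simp]: "valid_path (left_box \<delta> R)"
  unfolding left_box_def by (intro valid_path_join) auto

lemma pathstart_left_box [simp]: "pathstart (left_box \<delta> R) = \<i> * of_real R"
  and pathfinish_left_box [simp]: "pathfinish (left_box \<delta> R) = - (\<i> * of_real R)"
  by (simp_all add: left_box_def)

lemma path_image_left_box:
  "path_image (left_box \<delta> R) = closed_segment (\<i> * of_real R) (\<i> * of_real R - of_real \<delta>) \<union>
     closed_segment (\<i> * of_real R - of_real \<delta>) (- \<i> * of_real R - of_real \<delta>) \<union>
     closed_segment (- \<i> * of_real R - of_real \<delta>) (- \<i> * of_real R)"
  by (auto simp: left_box_def path_image_join)

lemma left_box_image:
  assumes "z \<in> path_image (left_box \<delta> R)" "\<delta> > 0" "R > 0"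
  shows "- \<delta> \<le> Re z" "\<bar>Im z\<bar> \<le> R" "- z \<notin> \<real>\<^sub>\<le>\<^sub>0"
proof -
  let ?K = "{z. -\<delta> \<le> Re z} \<inter> {z. Re z \<le> 0} \<inter> {z. -R \<le> Im z} \<inter> {z. Im z \<le> R}"
  let ?S1 = "closed_segment (\<i> * of_real R) (\<i> * of_real R - of_real \<delta>)"
  let ?S2 = "closed_segment (\<i> * of_real R - of_real \<delta>) (- \<i> * of_real R - of_real \<delta>)"
  let ?S3 = "closed_segment (- \<i> * of_real R - of_real \<delta>) (- \<i> * of_real R)"
  have cvx: "convex ?K"
    by (intro convex_Int convex_halfspace_Re_ge convex_halfspace_Re_le convex_halfspace_Im_ge convex_halfspace_Im_le)
  have z: "z \<in> ?S1 \<union> ?S2 \<union> ?S3" using assms by (simp only: path_image_left_box)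
  have "?S1 \<subseteq> ?K" "?S2 \<subseteq> ?K" "?S3 \<subseteq> ?K"
    by (rule closed_segment_subset[OF _ _ cvx]; use assms in simp)+
  hence zK: "z \<in> ?K" using z by blast
  thus "- \<delta> \<le> Re z" "\<bar>Im z\<bar> \<le> R" by auto
  have "?S1 \<subseteq> {z. Im z \<ge> R}"
    by (rule closed_segment_subset[OF _ _ convex_halfspace_Im_ge]) (use assms in simp_all)
  moreover have "?S2 \<subseteq> {z. Re z \<le> -\<delta>}"
    by (rule closed_segment_subset[OF _ _ convex_halfspace_Re_le]) (use assms in simp_all)
  moreover have "?S3 \<subseteq> {z. Im z \<le> -R}"
    by (rule closed_segment_subset[OF _ _ convex_halfspace_Im_le]) (use assms in simp_all)
  ultimately have "Im z \<noteq> 0 \<or> Re z < 0" using z assms by auto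
  thus "- z \<notin> \<real>\<^sub>\<le>\<^sub>0" by (auto simp: complex_nonpos_Reals_iff)
qed

lemma exp_3pi2: "exp (\<i> * of_real (3 * pi / 2)) = - \<i>"
proof -
  have "3 * pi / 2 = pi + pi / 2" by simp
  thus ?thesis unfolding cis_conv_exp[symmetric] using cis_mult[of pi "pi/2"] by (simp add: complex_eq_iff cos_add sin_add)
qed

lemma exp_pi2: "exp (\<i> * of_real (pi / 2)) = \<i>" "exp (\<i> * of_real (- (pi / 2))) = - \<i>"
  unfolding cis_conv_exp[symmetric] by (simp_all add: complex_eq_iff)

lemma has_contour_integral_inverse_arc:
  assumes "s < t" "R > 0"
  shows "((\<lambda>z. 1 / z) has_contour_integral (\<i> * of_real (t - s))) (part_circlepath 0 R s t)"
proof -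
  have "((\<lambda>x. \<i>) has_integral (t - s) *\<^sub>R \<i>) {s..t}"
    using has_integral_const_real[of \<i> s t] assms by simp
  hence "((\<lambda>x. \<i>) has_integral \<i> * of_real (t - s)) {s..t}"
    unfolding scaleR_conv_of_real by (subst mult.commute)
  thus ?thesis using assms
    by (subst has_contour_integral_part_circlepath_iff) (simp_all cong: has_integral_cong)
qed

text \<open>
  On the rectangle \<open>Ln (- z)\<close> is a primitive of \<open>1 / z\<close>, as its branch cut is the nonnegative real axis.
\<close>
lemma has_contour_integral_inverse_left_box:
  assumes "\<delta> > 0" "R > 0"
  shows "((\<lambda>z. 1 / z) has_contour_integral (\<i> * of_real pi)) (left_box \<delta> R)"
proof -
  have "((\<lambda>z. 1 / z) has_contour_integral (Ln (- pathfinish (left_box \<delta> R)) - Ln (- pathstart (left_box \<delta> R)))) (left_box \<delta> R)"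
  proof (rule contour_integral_primitive[where S = "path_image (left_box \<delta> R)"])
    fix x assume x: "x \<in> path_image (left_box \<delta> R)"
    hence "- x \<notin> \<real>\<^sub>\<le>\<^sub>0" using left_box_image(3) assms by blast
    moreover have "x \<noteq> 0" using calculation by auto
    ultimately show "((\<lambda>z. Ln (- z)) has_field_derivative 1 / x) (at x within path_image (left_box \<delta> R))"
      by (auto intro!: derivative_eq_intros simp: field_simps)
  qed auto
  moreover have "Ln (\<i> * of_real R) = of_real (ln R) + \<i> * of_real (pi / 2)"
    using Ln_times_of_real[of R \<i>] assms by (simp add: mult.commute[of "of_real R"] Ln_of_real)
  moreover have "Ln (- (\<i> * of_real R)) = of_real (ln R) - \<i> * of_real (pi / 2)"
    using Ln_times_of_real[of R "-\<i>"] assms by (simp add: mult.commute[of "of_real R"] Ln_of_real)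
  ultimately show ?thesis by simp
qed

text \<open>
  Subtracting \<open>\<phi> 0 / z\<close> leaves a holomorphic integrand, whose integral over the closed contour vanishes;
  the integral of \<open>1 / z\<close> is known on both pieces, which takes the place of a winding number. The left
  piece \<open>Q\<close> is a parameter because the two functions compared below need different left pieces.
\<close>
lemma cauchy_formula_two_pieces:
  assumes K: "convex K" "0 \<in> interior K" and \<phi>: "\<phi> holomorphic_on K" and R: "R > 0"
    and right: "path_image (right_arc R) \<subseteq> K"
    and Q: "valid_path Q" "path_image Q \<subseteq> K - {0}" "pathstart Q = \<i> * of_real R" "pathfinish Q = - \<i> * of_real R"
    and Q1: "((\<lambda>z. 1 / z) has_contour_integral (\<i> * of_real pi)) Q"
  shows "contour_integral (right_arc R) (\<lambda>z. \<phi> z / z) + contour_integral Q (\<lambda>z. \<phi> z / z) = 2 * of_real pi * \<i> * \<phi> 0"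
    and "(\<lambda>z. \<phi> z / z) contour_integrable_on right_arc R" and "(\<lambda>z. \<phi> z / z) contour_integrable_on Q"
proof -
  let ?F = "\<lambda>z. if z = 0 then deriv \<phi> 0 else (\<phi> z - \<phi> 0) / (z - 0)"
  let ?A = "right_arc R"
  have nz: "z \<noteq> 0" if "z \<in> path_image ?A" for z
    using in_path_image_part_circlepath[OF that] R by auto
  have vp: "valid_path (?A +++ Q)"
    using Q exp_pi2 by (intro valid_path_join) (auto simp del: of_real_divide of_real_minus)
  have F: "(?F has_contour_integral 0) (?A +++ Q)"
    by (rule Cauchy_theorem_convex_simple[OF pole_lemma[OF \<phi> K(2)] K(1) vp])
       (use Q right exp_pi2 in \<open>auto simp: path_image_join simp del: of_real_divide of_real_minus\<close>)
  hence int: "?F contour_integrable_on ?A" "?F contour_integrable_on Q"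
    using Q vp contour_integrable_join[of ?A Q ?F] by (auto simp: contour_integrable_on_def)
  have F0: "contour_integral ?A ?F + contour_integral Q ?F = 0"
    using int Q vp contour_integral_unique[OF F] contour_integral_join[of ?F ?A Q] by auto
  have A1: "((\<lambda>z. 1 / z) has_contour_integral (\<i> * of_real pi)) ?A"
    using has_contour_integral_inverse_arc[of "-(pi/2)" "pi/2" R] R by simp
  have 1: "((\<lambda>z. \<phi> z / z) has_contour_integral (contour_integral ?A ?F + \<phi> 0 * (\<i> * of_real pi))) ?A"
    by (rule has_contour_integral_eq[OF has_contour_integral_add[OF has_contour_integral_integral[OF int(1)]
           has_contour_integral_lmul[OF A1, of "\<phi> 0"]]])
       (use nz in \<open>auto simp: field_simps\<close>)
  have 2: "((\<lambda>z. \<phi> z / z) has_contour_integral (contour_integral Q ?F + \<phi> 0 * (\<i> * of_real pi))) Q"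
    by (rule has_contour_integral_eq[OF has_contour_integral_add[OF has_contour_integral_integral[OF int(2)]
           has_contour_integral_lmul[OF Q1, of "\<phi> 0"]]])
       (use Q in \<open>auto simp: field_simps\<close>)
  show "(\<lambda>z. \<phi> z / z) contour_integrable_on right_arc R" "(\<lambda>z. \<phi> z / z) contour_integrable_on Q"
    using 1 2 by (auto simp: contour_integrable_on_def)
  show "contour_integral (right_arc R) (\<lambda>z. \<phi> z / z) + contour_integral Q (\<lambda>z. \<phi> z / z) = 2 * of_real pi * \<i> * \<phi> 0"
    using contour_integral_unique[OF 1] contour_integral_unique[OF 2] F0
    by (simp add: algebra_simps add_eq_0_iff)
qed

text \<open>
  Along the horizontal side the factor \<open>N powr Re z\<close> decays exponentially in the distance from the
  imaginary axis, at rate \<open>ln N\<close>; its integral is at most \<open>1 / ln N\<close>.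
\<close>
lemma contour_integral_horizontal_le:
  assumes F: "continuous_on (closed_segment p (p - of_real \<delta>)) F"
    and M: "\<And>z. z \<in> closed_segment p (p - of_real \<delta>) \<Longrightarrow> norm (F z) \<le> M * real N powr Re z"
    and p: "Re p = 0" and \<delta>: "\<delta> > 0" and N: "N > 1"
  shows "norm (contour_integral (linepath p (p - of_real \<delta>)) F) \<le> M / ln (real N)"
proof -
  have M0: "M \<ge> 0"
    using order_trans[OF norm_ge_zero M[of p]] p N by simp
  define c where "c = \<delta> * ln (real N)"
  have c: "c > 0" using \<delta> N by (simp add: c_def)
  let ?l = "linepath p (p - of_real \<delta>)"
  have int: "F contour_integrable_on ?l"
    by (rule contour_integrable_continuous_linepath[OF F])
  have 1: "((\<lambda>x. F (?l x) * (p - of_real \<delta> - p)) has_integral contour_integral ?l F) {0..1}"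
    using has_contour_integral_integral[OF int] by (simp only: has_contour_integral_linepath)
  have 2: "((\<lambda>x. M * \<delta> * exp (- c * x)) has_integral
          (- M * \<delta> * exp (- c * 1) / c - (- M * \<delta> * exp (- c * 0) / c))) {0..1}"
    by (rule fundamental_theorem_of_calculus)
       (use c in \<open>auto intro!: derivative_eq_intros simp flip: has_real_derivative_iff_has_vector_derivative\<close>)
  have "norm (F (?l x) * (p - of_real \<delta> - p)) \<le> M * \<delta> * exp (- c * x)" if "x \<in> {0..1}" for x
  proof -
    have "?l x \<in> closed_segment p (p - of_real \<delta>)"
      using that linepath_in_path by auto
    from M[OF this] have "norm (F (?l x)) \<le> M * real N powr (- \<delta> * x)"
      using p by (simp add: linepath_def algebra_simps)
    also have "real N powr (- \<delta> * x) = exp (- c * x)"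
      using N by (simp add: powr_def c_def mult_ac)
    finally show ?thesis using \<delta> by (simp add: norm_mult mult_right_mono mult_ac)
  qed
  hence "norm (integral {0..1} (\<lambda>x. F (?l x) * (p - of_real \<delta> - p))) \<le> integral {0..1} (\<lambda>x. M * \<delta> * exp (- c * x))"
    using 1 2 by (intro integral_norm_bound_integral) (auto simp: integrable_on_def)
  hence "norm (contour_integral ?l F) \<le> - M * \<delta> * exp (- c * 1) / c - (- M * \<delta> * exp (- c * 0) / c)"
    unfolding integral_unique[OF 1] integral_unique[OF 2] .
  also have "\<dots> \<le> M * \<delta> / c" using M0 \<delta> c by simp
  also have "\<dots> = M / ln (real N)" using \<delta> by (simp add: c_def)
  finally show ?thesis .
qed

text \<open>
  On the circle of radius \<open>R\<close> one has \<open>1 / z = cnj z / R\<^sup>2\<close>, so the kernel \<open>1 / z + z / R\<^sup>2\<close> equals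
  \<open>2 * Re z / R\<^sup>2\<close>. This factor \<open>Re z\<close> compensates the \<open>1 / Re z\<close> in the bounds for the tail and for the
  partial sum of a Dirichlet series.
\<close>
lemma norm_newman_kernel:
  assumes "norm z = R" "R > 0"
  shows "norm ((1 + z\<^sup>2 / of_real (R\<^sup>2)) / z) = 2 * \<bar>Re z\<bar> / R\<^sup>2"
proof -
  have z: "z \<noteq> 0" using assms by auto
  have "of_real (R\<^sup>2) = z * cnj z" using assms by (simp only: complex_norm_square[symmetric])
  hence "(1 + z\<^sup>2 / of_real (R\<^sup>2)) / z = (cnj z + z) / of_real (R\<^sup>2)"
    using z by (simp add: field_simps power2_eq_square)
  also have "cnj z + z = of_real (2 * Re z)" by (simp add: complex_eq_iff)
  finally show ?thesis by (simp add: norm_divide norm_mult norm_power)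
qed

lemma right_arc_image: "z \<in> path_image (right_arc R) \<Longrightarrow> R > 0 \<Longrightarrow> norm z = R \<and> Re z \<ge> 0"
  by (auto simp: path_image_part_circlepath' closed_segment_eq_real_ivl norm_mult cos_ge_zero)

lemma left_arc_image:
  assumes "z \<in> path_image (left_arc R)" "R > 0"
  shows "norm z = R" "Re z \<le> 0"
proof -
  from assms obtain t where t: "pi / 2 \<le> t" "t \<le> 3 * pi / 2" "z = of_real R * cis t"
    by (auto simp: path_image_part_circlepath' closed_segment_eq_real_ivl)
  have "cos (t - pi) \<ge> 0" using t by (intro cos_ge_zero) auto
  hence "cos t \<le> 0" by (simp add: cos_diff)
  thus "norm z = R" "Re z \<le> 0" using t assms by (auto simp: norm_mult mult_nonneg_nonpos)
qed

lemma dirichlet_tail_le: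
  fixes a :: "nat \<Rightarrow> complex"
  assumes bnd: "\<And>n. norm (a n) \<le> C" and z: "Re z > 0" and N: "N > 0"
    and sums: "(\<lambda>n. a n * of_nat n powr (-z-1)) sums s"
  shows "norm (s - (\<Sum>n=1..N. a n * of_nat n powr (-z-1))) \<le> C * (real N powr (- Re z) / Re z)"
proof -
  let ?t = "\<lambda>n. a n * of_nat n powr (-z-1)"
  have C: "C \<ge> 0" using bnd[of 0] norm_ge_zero order_trans by blast
  have "(\<Sum>n<Suc N. ?t n) = (\<Sum>n=1..N. ?t n)"
    by (rule sum.mono_neutral_right) auto
  hence "(\<lambda>n. ?t (n + Suc N)) sums (s - (\<Sum>n=1..N. ?t n))"
    using sums_split_initial_segment[OF sums, of "Suc N"] by simp
  hence "s - (\<Sum>n=1..N. ?t n) = (\<Sum>n. ?t (n + Suc N))" by (simp add: sums_iff)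
  also have "norm \<dots> \<le> (\<Sum>n. C * real (n + Suc N) powr (- Re z - 1))"
  proof (rule norm_suminf_le)
    fix n
    have "norm (?t (n + Suc N)) = norm (a (n + Suc N)) * real (n + Suc N) powr (- Re z - 1)"
      unfolding norm_mult by (subst norm_of_nat_powr) auto
    also have "\<dots> \<le> C * real (n + Suc N) powr (- Re z - 1)"
      by (intro mult_right_mono bnd) auto
    finally show "norm (?t (n + Suc N)) \<le> C * real (n + Suc N) powr (- Re z - 1)" .
  qed (intro summable_mult suminf_powr_tail_le z N)
  also have "\<dots> = C * (\<Sum>n. real (n + Suc N) powr (- Re z - 1))"
    by (rule suminf_mult[OF suminf_powr_tail_le(1)[OF z N]])
  also have "\<dots> \<le> C * (real N powr (- Re z) / Re z)"
    by (intro mult_left_mono suminf_powr_tail_le z N C)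
  finally show ?thesis .
qed

lemma dirichlet_partial_sum_le:
  fixes a :: "nat \<Rightarrow> complex"
  assumes bnd: "\<And>n. norm (a n) \<le> C" and y: "Re z < 0" and N: "N > 0"
  shows "norm (\<Sum>n=1..N. a n * of_nat n powr (-z-1)) \<le> C * (real N powr (- Re z) / (- Re z) + real N powr (- Re z - 1))"
proof -
  have C: "C \<ge> 0" using bnd[of 0] norm_ge_zero order_trans by blast
  have "norm (\<Sum>n=1..N. a n * of_nat n powr (-z-1)) \<le> (\<Sum>n=1..N. C * real n powr (- Re z - 1))"
  proof (rule sum_norm_le)
    fix n assume n: "n \<in> {1..N}"
    have "norm (a n * of_nat n powr (-z-1)) = norm (a n) * real n powr (- Re z - 1)"
      unfolding norm_mult using n by (subst norm_of_nat_powr) auto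
    also have "\<dots> \<le> C * real n powr (- Re z - 1)"
      by (intro mult_right_mono bnd) auto
    finally show "norm (a n * of_nat n powr (-z-1)) \<le> C * real n powr (- Re z - 1)" .
  qed
  also have "\<dots> = C * (\<Sum>n=1..N. real n powr (- Re z - 1))" by (simp add: sum_distrib_left)
  also have "\<dots> \<le> C * (real N powr (- Re z) / (- Re z) + real N powr (- Re z - 1))"
    using sum_powr_le[of "- Re z" N] y N C by (intro mult_left_mono) auto
  finally show ?thesis .
qed

text \<open>
  Cauchy's formula with the kernel \<open>N powr z * (1 / z + z / R\<^sup>2)\<close> is applied to the limit function \<open>G\<close>, with
  the rectangle as left piece, and to the partial sum \<open>f N\<close>, which is entire, with the left half circle.
  On the right half circle the difference \<open>G - f N\<close> is a tail of the series; there and on the left half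
  circle the factors \<open>N powr Re z\<close> and \<open>Re z\<close> cancel, leaving \<open>O(1 / R + 1 / N)\<close>. On the rectangle \<open>G\<close> is merely
  bounded, but \<open>N powr Re z\<close> tends to \<open>0\<close>.
\<close>
lemma newman_remainder_bound:
  fixes a :: "nat \<Rightarrow> complex"
  assumes bnd: "\<And>n. norm (a n) \<le> C"
    and U: "open U" "{z. Re z \<ge> 0} \<subseteq> U" and G: "G holomorphic_on U"
    and sums: "\<And>z. Re z > 0 \<Longrightarrow> (\<lambda>n. a n * of_nat n powr (-z-1)) sums G z"
    and R: "R > 0"
  obtains M \<delta> where "\<delta> > 0" "\<And>N. N > 1 \<Longrightarrow>
     norm (G 0 - (\<Sum>n=1..N. a n * of_nat n powr (-1))) \<le> 2 * C / R + C / real N + (M / ln (real N) + M * real N powr (-\<delta>))"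
proof -
  have C: "C \<ge> 0" using bnd[of 0] norm_ge_zero order_trans by blast
  \<comment> \<open>By compactness, a neighbourhood of the segment from \<open>- \<i> R\<close> to \<open>\<i> R\<close> lies in the domain of \<open>G\<close>.\<close>
  obtain \<epsilon> where \<epsilon>: "\<epsilon> > 0" "(\<Union>x\<in>closed_segment (-\<i> * of_real R) (\<i> * of_real R). ball x \<epsilon>) \<subseteq> U"
  proof (rule compact_subset_open_imp_ball_epsilon_subset)
    show "closed_segment (-\<i> * of_real R) (\<i> * of_real R) \<subseteq> U"
      using U(2) closed_segment_subset[OF _ _ convex_halfspace_Re_ge, of "-\<i> * of_real R" 0 "\<i> * of_real R"] by auto
  qed (use U in auto)
  define \<delta> where "\<delta> = \<epsilon> / 2"
  have \<delta>: "\<delta> > 0" using \<epsilon> by (simp add: \<delta>_def)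
  define K where "K = {z. -\<delta> \<le> Re z} \<inter> {z. -R \<le> Im z} \<inter> {z. Im z \<le> R}"
  have K_cvx: "convex K" unfolding K_def
    by (intro convex_Int convex_halfspace_Re_ge convex_halfspace_Im_ge convex_halfspace_Im_le)
  have K_int: "0 \<in> interior K"
  proof (rule interiorI)
    show "open ({z. -\<delta> < Re z} \<inter> {z. -R < Im z} \<inter> {z. Im z < R})"
      by (intro open_Int open_halfspace_Re_gt open_halfspace_Im_gt open_halfspace_Im_lt)
  qed (use \<delta> R in \<open>auto simp: K_def\<close>)
  have K_U: "K \<subseteq> U"
  proof
    fix z assume z: "z \<in> K"
    show "z \<in> U"
    proof (cases "Re z \<ge> 0")
      case False
      have "\<i> * of_real (Im z) \<in> closed_segment (-\<i> * of_real R) (\<i> * of_real R)"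
        unfolding closed_segment_def using z R
        by (intro CollectI exI[of _ "(Im z + R) / (2 * R)"]) (auto simp: K_def complex_eq_iff field_simps)
      moreover have "z \<in> ball (\<i> * of_real (Im z)) \<epsilon>"
      proof -
        have "z - \<i> * of_real (Im z) = of_real (Re z)" by (simp add: complex_eq_iff)
        hence "dist z (\<i> * of_real (Im z)) = \<bar>Re z\<bar>" by (simp add: dist_norm)
        thus ?thesis using False z \<epsilon>(1) by (auto simp: K_def \<delta>_def dist_commute)
      qed
      ultimately show ?thesis using \<epsilon>(2) by blast
    qed (use U(2) in auto)
  qed
  let ?P = "left_box \<delta> R"
  have P_img: "path_image ?P \<subseteq> K - {0}"
    using left_box_image[OF _ \<delta> R] by (fastforce simp: K_def abs_le_iff)
  define H where "H = (\<lambda>z. G z * ((1 + z\<^sup>2 / of_real (R\<^sup>2)) / z))"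
  have GK: "G holomorphic_on K" using G K_U holomorphic_on_subset by blast
  have "continuous_on (path_image ?P) H"
    unfolding H_def using P_img R holomorphic_on_imp_continuous_on[OF GK]
    by (auto intro!: continuous_intros elim: continuous_on_subset)
  hence "compact (H ` path_image ?P)"
    by (rule compact_continuous_image) (auto intro!: compact_path_image valid_path_imp_path)
  then obtain M where M: "\<And>z. z \<in> path_image ?P \<Longrightarrow> norm (H z) \<le> M"
    using compact_imp_bounded bounded_iff by (metis imageI)
  \<comment> \<open>One constant that absorbs the bounds for all three sides of the rectangle.\<close>
  define M' where "M' = M / pi + M * R / pi"
  define k where "k = (\<lambda>N z. of_nat N powr z * (1 + z\<^sup>2 / of_real (R\<^sup>2)) :: complex)"
  define f where "f = (\<lambda>N z. \<Sum>n=1..N. a n * of_nat n powr (-z-1))"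
  have k_norm: "norm (k N z / z) = real N powr Re z * (2 * \<bar>Re z\<bar> / R\<^sup>2)" if "N > 0" "norm z = R" for N z
    using norm_newman_kernel[OF that(2) R] that(1)
    by (simp add: k_def norm_mult norm_of_nat_powr times_divide_eq_right[symmetric] del: times_divide_eq_right)
  have k_0: "k N 0 = 1" if "N > 0" for N using that by (simp add: k_def)
  have k_hol: "k N holomorphic_on A" for N A
    unfolding k_def using R by (intro holomorphic_intros) auto
  have f_hol: "f N holomorphic_on A" for N A
    unfolding f_def by (intro holomorphic_intros)
  have "norm (G 0 - f N 0) \<le> 2 * C / R + C / real N + (M' / ln (real N) + M' * real N powr (-\<delta>))"
    if N: "N > 1" for N
  proof -
    have N0: "N > 0" using N by simp
    let ?\<phi>1 = "\<lambda>z. G z * k N z" and ?\<phi>2 = "\<lambda>z. f N z * k N z"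
    have right_K: "path_image (right_arc R) \<subseteq> K"
    proof
      fix z assume "z \<in> path_image (right_arc R)"
      from right_arc_image[OF this R] show "z \<in> K"
        using abs_Im_le_cmod[of z] \<delta> by (auto simp: K_def)
    qed
    have hol1: "?\<phi>1 holomorphic_on K" by (intro holomorphic_intros GK k_hol)
    have hol2: "?\<phi>2 holomorphic_on UNIV" by (intro holomorphic_intros f_hol k_hol)
    have left_img: "path_image (left_arc R) \<subseteq> UNIV - {0}"
      using left_arc_image(1)[OF _ R] R by force
    have left_int: "((\<lambda>z. 1 / z) has_contour_integral (\<i> * of_real pi)) (left_arc R)"
      using has_contour_integral_inverse_arc[of "pi/2" "3*pi/2" R] R by simp
    have left_ends: "pathstart (left_arc R) = \<i> * of_real R" "pathfinish (left_arc R) = - \<i> * of_real R"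
      using exp_pi2 exp_3pi2 by (simp_all del: of_real_divide of_real_mult)
    note c1 = cauchy_formula_two_pieces[OF K_cvx K_int hol1 R right_K valid_path_left_box P_img
       pathstart_left_box _ has_contour_integral_inverse_left_box[OF \<delta> R]]
    note c2 = cauchy_formula_two_pieces[OF convex_UNIV _ hol2 R subset_UNIV _ left_img left_ends left_int]
    let ?D = "\<lambda>z. ?\<phi>1 z / z - ?\<phi>2 z / z"
    \<comment> \<open>The kernel vanishes at the end points of the arc, where the tail of the series is not controlled.\<close>
    have A: "norm (contour_integral (right_arc R) ?D) \<le> (2 * C / R\<^sup>2) * R * (pi/2 - (-(pi/2)))"
    proof (rule has_contour_integral_bound_part_circlepath[OF has_contour_integral_integral])
      show "?D contour_integrable_on right_arc R"
        using c1(2) c2(2) by (intro contour_integrable_diff) auto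
      fix z assume "z \<in> path_image (right_arc R)"
      from right_arc_image[OF this R] have z: "norm z = R" "Re z \<ge> 0" by auto
      have "norm (?D z) = norm (G z - f N z) * norm (k N z / z)"
        by (simp add: norm_mult[symmetric] algebra_simps diff_divide_distrib)
      also have "norm (k N z / z) = real N powr Re z * (2 * \<bar>Re z\<bar> / R\<^sup>2)"
        by (rule k_norm[OF N0 z(1)])
      also have "norm (G z - f N z) * \<dots> \<le> 2 * C / R\<^sup>2"
      proof (cases "Re z = 0")
        case False
        hence x: "Re z > 0" using z by simp
        have "norm (G z - f N z) * (real N powr Re z * (2 * \<bar>Re z\<bar> / R\<^sup>2)) \<le>
                (C * (real N powr (- Re z) / Re z)) * (real N powr Re z * (2 * \<bar>Re z\<bar> / R\<^sup>2))"
          unfolding f_def by (intro mult_right_mono dirichlet_tail_le bnd x N0 sums) auto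
        also have "\<dots> = 2 * C / R\<^sup>2 * (real N powr (- Re z) * real N powr Re z)"
          using x by simp
        also have "real N powr (- Re z) * real N powr Re z = 1"
          using N0 by (simp flip: powr_add)
        finally show ?thesis by simp
      qed (use C in auto)
      finally show "norm (?D z) \<le> 2 * C / R\<^sup>2" .
    qed (use C R in auto)
    have B: "norm (contour_integral (left_arc R) (\<lambda>z. ?\<phi>2 z / z)) \<le> (2 * C / R\<^sup>2 + 2 * C / (real N * R)) * R * (3*pi/2 - pi/2)"
    proof (rule has_contour_integral_bound_part_circlepath[OF has_contour_integral_integral])
      show "(\<lambda>z. ?\<phi>2 z / z) contour_integrable_on left_arc R"
        using c2(3) by auto
      fix z assume "z \<in> path_image (left_arc R)"
      from left_arc_image[OF this R] have z: "norm z = R" "Re z \<le> 0" by auto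
      have "norm (?\<phi>2 z / z) = norm (f N z) * norm (k N z / z)"
        by (simp add: norm_mult norm_divide)
      also have "norm (k N z / z) = real N powr Re z * (2 * \<bar>Re z\<bar> / R\<^sup>2)"
        by (rule k_norm[OF N0 z(1)])
      also have "norm (f N z) * \<dots> \<le> 2 * C / R\<^sup>2 + 2 * C / (real N * R)"
      proof (cases "Re z = 0")
        case False
        define y where "y = - Re z"
        have y: "y > 0" using False z by (simp add: y_def)
        have x: "Re z < 0" using False z by simp
        have yR: "y \<le> R" using abs_Re_le_cmod[of z] z by (simp add: y_def)
        have "norm (f N z) * (real N powr Re z * (2 * \<bar>Re z\<bar> / R\<^sup>2)) \<le>
                (C * (real N powr (- Re z) / (- Re z) + real N powr (- Re z - 1))) * (real N powr Re z * (2 * \<bar>Re z\<bar> / R\<^sup>2))"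
          unfolding f_def by (intro mult_right_mono dirichlet_partial_sum_le bnd N0 x) auto
        also have "\<dots> = C * (real N powr y / y + real N powr (y - 1)) * (real N powr (-y) * (2 * y / R\<^sup>2))"
          using y by (simp add: y_def)
        also have "\<dots> = 2 * C / R\<^sup>2 + 2 * C / (real N * R) * (y / R)"
          using y N0 R by (simp add: powr_diff powr_minus field_simps power2_eq_square)
        also have "\<dots> \<le> 2 * C / R\<^sup>2 + 2 * C / (real N * R) * 1"
          using yR R C by (intro add_left_mono mult_left_mono) auto
        finally show ?thesis by simp
      qed (use C R in auto)
      finally show "norm (?\<phi>2 z / z) \<le> 2 * C / R\<^sup>2 + 2 * C / (real N * R)" .
    qed (use C R in auto)
    have "\<i> * of_real R \<in> path_image ?P" by (metis pathstart_in_path_image pathstart_left_box)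
    hence M0: "M \<ge> 0" using M order_trans[OF norm_ge_zero] by blast
    have phi_le: "norm (?\<phi>1 z / z) \<le> M * real N powr Re z" if "z \<in> path_image ?P" for z
    proof -
      have "norm (?\<phi>1 z / z) = norm (H z) * real N powr Re z"
        using N0 by (simp add: H_def k_def norm_mult norm_divide norm_of_nat_powr)
      also have "\<dots> \<le> M * real N powr Re z" by (intro mult_right_mono M that) auto
      finally show ?thesis .
    qed
    have phi_cont: "continuous_on S (\<lambda>z. ?\<phi>1 z / z)" if "S \<subseteq> path_image ?P" for S
    proof (rule continuous_on_divide)
      show "continuous_on S ?\<phi>1"
        by (rule continuous_on_subset[OF holomorphic_on_imp_continuous_on[OF hol1]]) (use P_img that in blast)
    qed (use P_img that in auto)
    let ?l1 = "linepath (\<i> * of_real R) (\<i> * of_real R - of_real \<delta>)"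
    let ?l2 = "linepath (\<i> * of_real R - of_real \<delta>) (- \<i> * of_real R - of_real \<delta>)"
    let ?l3 = "linepath (- \<i> * of_real R) (- \<i> * of_real R - of_real \<delta>)"
    have segs: "closed_segment (\<i> * of_real R) (\<i> * of_real R - of_real \<delta>) \<subseteq> path_image ?P"
        "closed_segment (\<i> * of_real R - of_real \<delta>) (- \<i> * of_real R - of_real \<delta>) \<subseteq> path_image ?P"
        "closed_segment (- \<i> * of_real R) (- \<i> * of_real R - of_real \<delta>) \<subseteq> path_image ?P"
      unfolding path_image_left_box by (auto simp: closed_segment_commute)
    have ints: "(\<lambda>z. ?\<phi>1 z / z) contour_integrable_on ?l1" "(\<lambda>z. ?\<phi>1 z / z) contour_integrable_on ?l2"
       "(\<lambda>z. ?\<phi>1 z / z) contour_integrable_on ?l3"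
      by (rule contour_integrable_continuous_linepath[OF phi_cont[OF segs(1)]]
               contour_integrable_continuous_linepath[OF phi_cont[OF segs(2)]]
               contour_integrable_continuous_linepath[OF phi_cont[OF segs(3)]])+
    have "contour_integral ?P (\<lambda>z. ?\<phi>1 z / z) = contour_integral ?l1 (\<lambda>z. ?\<phi>1 z / z) +
            contour_integral ?l2 (\<lambda>z. ?\<phi>1 z / z) - contour_integral ?l3 (\<lambda>z. ?\<phi>1 z / z)"
    proof -
      have "((\<lambda>z. ?\<phi>1 z / z) has_contour_integral - contour_integral ?l3 (\<lambda>z. ?\<phi>1 z / z)) (reversepath ?l3)"
        by (rule has_contour_integral_reversepath[OF valid_path_linepath has_contour_integral_integral[OF ints(3)]])
      hence l3: "((\<lambda>z. ?\<phi>1 z / z) has_contour_integral - contour_integral ?l3 (\<lambda>z. ?\<phi>1 z / z))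
                   (linepath (- \<i> * of_real R - of_real \<delta>) (- \<i> * of_real R))"
        by (simp only: reversepath_linepath)
      have "((\<lambda>z. ?\<phi>1 z / z) has_contour_integral (contour_integral ?l1 (\<lambda>z. ?\<phi>1 z / z) +
            (contour_integral ?l2 (\<lambda>z. ?\<phi>1 z / z) + - contour_integral ?l3 (\<lambda>z. ?\<phi>1 z / z)))) ?P"
        unfolding left_box_def
        by (rule has_contour_integral_join[OF has_contour_integral_integral[OF ints(1)]
                   has_contour_integral_join[OF has_contour_integral_integral[OF ints(2)] l3]])
           (simp_all add: valid_path_join)
      thus ?thesis by (simp add: contour_integral_unique)
    qed
    also have "norm \<dots> \<le> M / ln (real N) + M * real N powr (-\<delta>) * (2 * R) + M / ln (real N)"
    proof (rule order_trans[OF norm_triangle_ineq4 add_mono[OF order_trans[OF norm_triangle_ineq add_mono]]])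
      show "norm (contour_integral ?l1 (\<lambda>z. ?\<phi>1 z / z)) \<le> M / ln (real N)"
        by (rule contour_integral_horizontal_le[OF phi_cont[OF segs(1)] phi_le[OF subsetD[OF segs(1)]] _ \<delta> N]) simp_all
      show "norm (contour_integral ?l3 (\<lambda>z. ?\<phi>1 z / z)) \<le> M / ln (real N)"
        by (rule contour_integral_horizontal_le[OF phi_cont[OF segs(3)] phi_le[OF subsetD[OF segs(3)]] _ \<delta> N]) simp_all
      have "norm (contour_integral ?l2 (\<lambda>z. ?\<phi>1 z / z)) \<le> M * real N powr (-\<delta>) *
              norm ((- \<i> * of_real R - of_real \<delta>) - (\<i> * of_real R - of_real \<delta>))"
      proof (rule contour_integral_bound_linepath[OF ints(2)])
        show "0 \<le> M * real N powr (-\<delta>)" using M0 by simp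
        fix z assume z: "z \<in> closed_segment (\<i> * of_real R - of_real \<delta>) (- \<i> * of_real R - of_real \<delta>)"
        then obtain u where "z = (1 - u) *\<^sub>R (\<i> * of_real R - of_real \<delta>) + u *\<^sub>R (- \<i> * of_real R - of_real \<delta>)"
          by (auto simp: closed_segment_def)
        hence "Re z = - ((1 - u) * \<delta>) - u * \<delta>" by (simp add: left_diff_distrib)
        hence "Re z = - \<delta>" by (simp add: algebra_simps)
        thus "norm (?\<phi>1 z / z) \<le> M * real N powr (-\<delta>)" using phi_le[of z] segs(2) z by auto
      qed
      also have "(- \<i> * of_real R - of_real \<delta>) - (\<i> * of_real R - of_real \<delta>) = - (2 * \<i> * of_real R :: complex)"
        by simp
      also have "norm \<dots> = 2 * R" using R by (simp add: norm_mult)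
      finally show "norm (contour_integral ?l2 (\<lambda>z. ?\<phi>1 z / z)) \<le> M * real N powr (-\<delta>) * (2 * R)" .
    qed
    finally have P: "norm (contour_integral ?P (\<lambda>z. ?\<phi>1 z / z)) \<le> M / ln (real N) + M * real N powr (-\<delta>) * (2 * R) + M / ln (real N)" .
    have "2 * of_real pi * \<i> * (G 0 - f N 0) = 2 * of_real pi * \<i> * ?\<phi>1 0 - 2 * of_real pi * \<i> * ?\<phi>2 0"
      using k_0[OF N0] by (simp add: algebra_simps)
    also have "\<dots> = (contour_integral (right_arc R) (\<lambda>z. ?\<phi>1 z / z) + contour_integral ?P (\<lambda>z. ?\<phi>1 z / z)) -
                    (contour_integral (right_arc R) (\<lambda>z. ?\<phi>2 z / z) + contour_integral (left_arc R) (\<lambda>z. ?\<phi>2 z / z))"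
      using c1(1) c2(1) by simp
    also have "\<dots> = contour_integral (right_arc R) ?D + contour_integral ?P (\<lambda>z. ?\<phi>1 z / z)
                    - contour_integral (left_arc R) (\<lambda>z. ?\<phi>2 z / z)"
      using c1(2) c2(2) by (subst contour_integral_diff) auto
    finally have eq: "2 * of_real pi * \<i> * (G 0 - f N 0) = \<dots>" .
    have "2 * pi * norm (G 0 - f N 0) = norm (2 * of_real pi * \<i> * (G 0 - f N 0))"
      by (simp add: norm_mult)
    also have "\<dots> \<le> (2 * C / R\<^sup>2) * R * (pi/2 - (-(pi/2))) + (M / ln (real N) + M * real N powr (-\<delta>) * (2 * R) + M / ln (real N))
                       + (2 * C / R\<^sup>2 + 2 * C / (real N * R)) * R * (3*pi/2 - pi/2)"
      unfolding eq by (intro order_trans[OF norm_triangle_ineq4] add_mono order_trans[OF norm_triangle_ineq] A B P)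
    also have "\<dots> = 2 * pi * (2 * C / R + C / real N + (M / pi / ln (real N) + M * R / pi * real N powr (-\<delta>)))"
      using R N by (simp add: field_simps power2_eq_square)
    finally have "norm (G 0 - f N 0) \<le> 2 * C / R + C / real N + (M / pi / ln (real N) + M * R / pi * real N powr (-\<delta>))"
      by (subst (asm) mult_le_cancel_left_pos) auto
    also have "\<dots> \<le> 2 * C / R + C / real N + (M' / ln (real N) + M' * real N powr (-\<delta>))"
    proof -
      show ?thesis using R N M0 unfolding M'_def
        by (intro add_left_mono add_mono mult_right_mono divide_right_mono) auto
    qed
    finally show ?thesis .
  qed
  thus ?thesis using that[OF \<delta>, of M'] by (simp add: f_def)
qed

text \<open>
  The remainder is at most \<open>2 * C / R\<close> up to terms tending to \<open>0\<close> as \<open>N\<close> grows, and \<open>R\<close> is arbitrary.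
\<close>
theorem newman_tauberian:
  fixes a :: "nat \<Rightarrow> complex"
  assumes bnd: "\<And>n. norm (a n) \<le> C"
    and U: "open U" "{z. Re z \<ge> 0} \<subseteq> U" and G: "G holomorphic_on U"
    and sums: "\<And>z. Re z > 0 \<Longrightarrow> (\<lambda>n. a n * of_nat n powr (-z-1)) sums G z"
  shows "(\<lambda>N. \<Sum>n=1..N. a n * of_nat n powr (-1)) \<longlonglongrightarrow> G 0"
proof (rule LIMSEQ_I)
  fix e :: real assume e: "e > 0"
  have C: "C \<ge> 0" using bnd[of 0] norm_ge_zero order_trans by blast
  define R where "R = (4 * C + 1) / e"
  have R: "R > 0" using e C by (simp add: R_def)
  have "2 * C / R \<le> e / 2" using e C by (simp add: R_def field_simps)
  obtain M \<delta> where \<delta>: "\<delta> > 0" and M: "\<And>N. N > 1 \<Longrightarrow>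
     norm (G 0 - (\<Sum>n=1..N. a n * of_nat n powr (-1))) \<le> 2 * C / R + C / real N + (M / ln (real N) + M * real N powr (-\<delta>))"
  proof (rule newman_remainder_bound[where a = a and C = C and G = G and U = U and R = R])
  qed (use U G R bnd sums that in blast)+
  have "(\<lambda>N. C / real N + (M / ln (real N) + M * real N powr (-\<delta>))) \<longlonglongrightarrow> 0"
    using \<delta> by real_asymp
  hence "\<forall>\<^sub>F N in sequentially. C / real N + (M / ln (real N) + M * real N powr (-\<delta>)) < e / 2"
    using e by (intro order_tendstoD) auto
  hence "\<forall>\<^sub>F N in sequentially. norm ((\<Sum>n=1..N. a n * of_nat n powr (-1)) - G 0) < e"
    using eventually_gt_at_top[of 1]
  proof eventually_elim
    case (elim N)
    show ?case using M[OF elim(2)] elim(1) \<open>2 * C / R \<le> e / 2\<close>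
      by (subst norm_minus_commute) linarith
  qed
  thus "\<exists>no. \<forall>N\<ge>no. norm ((\<Sum>n=1..N. a n * of_nat n powr (-1)) - G 0) < e"
    by (simp add: eventually_at_top_linorder)
qed

section \<open>A bound of Chebyshev\<close>

definition chebyshev_psi :: "nat \<Rightarrow> real" where
  "chebyshev_psi n = (\<Sum>d=1..n. mangoldt d)"

lemma chebyshev_psi_0 [simp]: "chebyshev_psi 0 = 0"
  by (simp add: chebyshev_psi_def)

lemma chebyshev_psi_Suc: "chebyshev_psi (Suc n) = chebyshev_psi n + mangoldt (Suc n)"
  by (simp add: chebyshev_psi_def)

lemma chebyshev_psi_mono: "m \<le> n \<Longrightarrow> chebyshev_psi m \<le> chebyshev_psi n"
  unfolding chebyshev_psi_def by (intro sum_mono2) (auto simp: mangoldt_nonneg)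

lemma chebyshev_psi_nonneg: "chebyshev_psi n \<ge> 0"
  unfolding chebyshev_psi_def by (intro sum_nonneg) (auto simp: mangoldt_nonneg)

text \<open>
  Passing from \<open>n\<close> to \<open>n + 1\<close> raises \<open>n div d\<close> by one exactly for the divisors \<open>d\<close> of \<open>n + 1\<close>.
\<close>
lemma ln_fact_eq_sum_mangoldt: "ln (fact n) = (\<Sum>d=1..n. mangoldt d * real (n div d))"
proof (induction n)
  case (Suc n)
  have "(\<Sum>d=1..Suc n. mangoldt d * real (Suc n div d)) =
          (\<Sum>d=1..Suc n. mangoldt d * real (n div d) + (if d dvd Suc n then mangoldt d else 0))"
    by (intro sum.cong) (auto simp: div_Suc dvd_eq_mod_eq_0 algebra_simps)
  also have "\<dots> = (\<Sum>d=1..Suc n. mangoldt d * real (n div d)) + (\<Sum>d=1..Suc n. if d dvd Suc n then mangoldt d else 0)"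
    by (rule sum.distrib)
  also have "(\<Sum>d=1..Suc n. mangoldt d * real (n div d)) = ln (fact n)"
    using Suc.IH by simp
  also have "(\<Sum>d=1..Suc n. if d dvd Suc n then mangoldt d else 0) = (\<Sum>d | d dvd Suc n. (mangoldt d :: real))"
  proof -
    have "d \<in> {1..Suc n}" if "d dvd Suc n" for d
      using that dvd_imp_le[OF that] by (cases "d = 0") auto
    hence "{d. d dvd Suc n} = {d \<in> {1..Suc n}. d dvd Suc n}" by blast
    thus ?thesis by (simp only: sum.inter_filter[OF finite_atLeastAtMost])
  qed
  also have "\<dots> = ln (real (Suc n))" by (subst mangoldt_sum) auto
  also have "ln (fact n) + ln (real (Suc n)) = ln (fact (Suc n))"
    by (simp add: ln_mult)
  finally show ?case ..
qed auto

text \<open>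
  Chebyshev's argument: in \<open>ln (2 * n choose n)\<close> the von Mangoldt function has the weights
  \<open>2 * n div d - 2 * (n div d)\<close>, which are nonnegative, and equal to \<open>1\<close> for \<open>n < d \<le> 2 * n\<close>; and the
  binomial coefficient is at most \<open>2 ^ (2 * n)\<close>.
\<close>
lemma chebyshev_psi_double: "chebyshev_psi (2 * n) - chebyshev_psi n \<le> 2 * real n"
proof -
  have "chebyshev_psi (2 * n) - chebyshev_psi n = (\<Sum>d\<in>{1..2*n}-{1..n}. mangoldt d)"
    unfolding chebyshev_psi_def by (subst sum_diff) auto
  also have "\<dots> = (\<Sum>d\<in>{1..2*n}-{1..n}. mangoldt d * (real (2 * n div d) - 2 * real (n div d)))"
  proof (intro sum.cong refl)
    fix d assume d: "d \<in> {1..2*n}-{1..n}"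
    hence "2 * n div d = 1" by (intro div_nat_eqI) auto
    moreover have "n div d = 0" using d by auto
    ultimately show "mangoldt d = mangoldt d * (real (2 * n div d) - 2 * real (n div d))"
      by simp
  qed
  also have "\<dots> \<le> (\<Sum>d\<in>{1..2*n}. mangoldt d * (real (2 * n div d) - 2 * real (n div d)))"
  proof (intro sum_mono2)
    fix d
    have "2 * (n div d) * d \<le> 2 * n" by (metis mult.assoc mult_le_mono2 times_div_less_eq_dividend mult.commute)
    hence "2 * (n div d) \<le> 2 * n div d"
      by (cases "d = 0") (simp_all add: less_eq_div_iff_mult_less_eq)
    hence "real (2 * (n div d)) \<le> real (2 * n div d)" by (rule of_nat_mono)
    hence "2 * real (n div d) \<le> real (2 * n div d)" by simp
    thus "0 \<le> mangoldt d * (real (2 * n div d) - 2 * real (n div d))"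
      by (intro mult_nonneg_nonneg mangoldt_nonneg) simp
  qed auto
  also have "\<dots> = (\<Sum>d\<in>{1..2*n}. mangoldt d * real (2 * n div d)) - 2 * (\<Sum>d\<in>{1..2*n}. mangoldt d * real (n div d))"
    by (simp add: sum_subtractf sum_distrib_left algebra_simps)
  also have "(\<Sum>d\<in>{1..2*n}. mangoldt d * real (n div d)) = (\<Sum>d\<in>{1..n}. mangoldt d * real (n div d))"
    by (intro sum.mono_neutral_right) auto
  also have "(\<Sum>d\<in>{1..2*n}. mangoldt d * real (2 * n div d)) - 2 * \<dots> = ln (fact (2 * n)) - 2 * ln (fact n)"
    by (simp only: ln_fact_eq_sum_mangoldt)
  also have "\<dots> = ln (real (2 * n choose n))"
    by (subst binomial_fact) (auto simp: ln_div ln_mult)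
  also have "\<dots> \<le> ln (2 ^ (2 * n))"
  proof (subst ln_le_cancel_iff)
    have "2 * n choose n \<le> 2 ^ (2 * n)" by (rule binomial_le_pow2)
    thus "real (2 * n choose n) \<le> 2 ^ (2 * n)" by (metis of_nat_le_iff of_nat_numeral of_nat_power)
  qed auto
  also have "\<dots> = 2 * real n * ln 2" by (simp add: ln_realpow)
  also have "\<dots> \<le> 2 * real n * 1" using ln_2_less_1 by (intro mult_left_mono) auto
  finally show ?thesis by simp
qed

lemma chebyshev_psi_le: "chebyshev_psi n \<le> 4 * real n"
proof (induction n rule: less_induct)
  case (less n)
  show ?case
  proof (cases "n \<le> 1")
    case True
    hence "n = 0 \<or> n = 1" by auto
    thus ?thesis by (auto simp: chebyshev_psi_def)
  next
    case False
    define m where "m = (n + 1) div 2"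
    have m: "m < n" "n \<le> 2 * m" "2 * m \<le> n + 1" using False by (auto simp: m_def)
    have "chebyshev_psi n \<le> chebyshev_psi (2 * m)" by (intro chebyshev_psi_mono m)
    also have "\<dots> \<le> chebyshev_psi m + 2 * real m" using chebyshev_psi_double[of m] by simp
    also have "\<dots> \<le> 4 * real m + 2 * real m" using less.IH[OF m(1)] by simp
    also have "\<dots> \<le> 4 * real n" using m False by linarith
    finally show ?thesis .
  qed
qed

section \<open>Analytic continuation of the error series\<close>

definition psi_error :: "nat \<Rightarrow> real" where "psi_error n = chebyshev_psi n - real n"

lemma abs_psi_error_le: "\<bar>psi_error n\<bar> \<le> 4 * real n"
  using chebyshev_psi_le[of n] chebyshev_psi_nonneg[of n] by (simp add: psi_error_def)

lemma psi_error_0 [simp]: "psi_error 0 = 0" by (simp add: psi_error_def)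

text \<open>
  By definition of \<open>zeta_term\<close>, \<open>s * n powr (- s - 1)\<close> is \<open>n powr (- s) - (n + 1) powr (- s)\<close> plus
  \<open>zeta_term n (s + 1)\<close>. This is the resulting correction when the error series is summed by parts.
\<close>
definition psi_correction :: "complex \<Rightarrow> complex" where
  "psi_correction s = (\<Sum>n. of_real (psi_error n) * zeta_term n (s + 1))"

lemma psi_correction_holomorphic: "psi_correction holomorphic_on {s. Re s > 0}"
  and summable_psi_correction: "Re s > 0 \<Longrightarrow> summable (\<lambda>n. of_real (psi_error n) * zeta_term n (s + 1))"
proof -
  have *: "norm (of_real (psi_error n) * zeta_term n (s + 1)) \<le> 4 * (1 + norm s)\<^sup>2 * real n powr (0 - 1 - Re s)"
    if "n > 0" "Re s > 0" for n s
  proof -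
    have 1: "norm (s + 1) * norm s \<le> (1 + norm s)\<^sup>2"
    proof -
      have "norm (s + 1) \<le> norm s + 1" using norm_triangle_ineq[of s 1] by simp
      hence "norm (s + 1) * norm s \<le> (1 + norm s) * (1 + norm s)" by (intro mult_mono) auto
      thus ?thesis by (simp only: power2_eq_square)
    qed
    have e: "- 1 - Re (s + 1) = - 2 - Re s" by simp
    have "norm (zeta_term n (s + 1)) \<le> norm (s + 1) * norm s * real n powr (- 2 - Re s)"
      using norm_zeta_term_le[of n "s + 1", unfolded e] that by simp
    moreover have "norm (complex_of_real (psi_error n)) \<le> 4 * real n"
      using abs_psi_error_le[of n] by simp
    ultimately have "norm (of_real (psi_error n) * zeta_term n (s + 1)) \<le>
            (4 * real n) * (norm (s + 1) * norm s * real n powr (- 2 - Re s))"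
      unfolding norm_mult by (intro mult_mono) auto
    also have "\<dots> = 4 * (norm (s + 1) * norm s) * (real n * real n powr (- 2 - Re s))"
      by (simp only: mult_ac)
    also have "real n * real n powr (- 2 - Re s) = real n powr (0 - 1 - Re s)"
      using that powr_mult_base[of "real n" "- 2 - Re s"] by simp
    also have "4 * (norm (s + 1) * norm s) * \<dots> \<le> 4 * (1 + norm s)\<^sup>2 * \<dots>"
      by (intro mult_right_mono mult_left_mono 1) auto
    finally show ?thesis .
  qed
  have hol: "(\<lambda>s. of_real (psi_error n) * zeta_term n (s + 1)) holomorphic_on A" for n A
    unfolding zeta_term_def by (intro holomorphic_intros)
  show "psi_correction holomorphic_on {s. Re s > 0}"
    unfolding psi_correction_def
    by (rule holomorphic_on_series_powr(1)[OF hol *]) auto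
  show "Re s > 0 \<Longrightarrow> summable (\<lambda>n. of_real (psi_error n) * zeta_term n (s + 1))"
    by (rule holomorphic_on_series_powr(2)[OF hol *]) auto
qed

text \<open>
  Summation by parts: the increment of the error at \<open>n + 1\<close> is the von Mangoldt function minus \<open>1\<close>, and
  the boundary terms vanish since the error is \<open>O(n)\<close> and \<open>Re s > 1\<close>.
\<close>
lemma psi_error_sums_by_parts:
  assumes s: "Re s > 1"
  shows "(\<lambda>n. of_real (psi_error n) * (of_nat n powr (-s) - of_nat (Suc n) powr (-s))) sums
           (mangoldt_series s - (\<Sum>n. of_nat n powr (- s)))"
proof -
  let ?p = "\<lambda>n. of_nat n powr (-s) :: complex"
  have "(\<lambda>n. mangoldt n * ?p n - ?p n) sums (mangoldt_series s - (\<Sum>n. ?p n))"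
    unfolding mangoldt_series_def
    by (intro sums_diff summable_sums summable_of_nat_powr s summable_norm_cancel[OF summable_norm_mangoldt_powr[OF s]])
  hence 1: "(\<lambda>n. mangoldt (Suc n) * ?p (Suc n) - ?p (Suc n)) sums (mangoldt_series s - (\<Sum>n. ?p n))"
    by (subst sums_Suc_iff) simp
  have "(\<lambda>n. of_real (psi_error n) * ?p n) \<longlonglongrightarrow> 0"
  proof (rule Lim_null_comparison)
    show "\<forall>\<^sub>F n in sequentially. norm (of_real (psi_error n) * ?p n) \<le> 4 * real n * real n powr (- Re s)"
      using eventually_gt_at_top[of 0]
    proof eventually_elim
      case (elim n)
      show ?case unfolding norm_mult norm_of_nat_powr[OF elim]
        using abs_psi_error_le[of n] by (simp add: mult_right_mono)
    qed
    show "(\<lambda>n. 4 * real n * real n powr (- Re s)) \<longlonglongrightarrow> 0" using s by real_asymp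
  qed
  from telescope_sums'[OF this]
  have 2: "(\<lambda>n. of_real (psi_error n) * ?p n - of_real (psi_error (Suc n)) * ?p (Suc n)) sums 0"
    by simp
  have eq: "of_real (psi_error n) * ?p n - of_real (psi_error (Suc n)) * ?p (Suc n) +
              (mangoldt (Suc n) * ?p (Suc n) - ?p (Suc n)) =
            of_real (psi_error n) * (?p n - ?p (Suc n))" for n
  proof -
    have "psi_error (Suc n) = psi_error n + mangoldt (Suc n) - 1"
      by (simp add: psi_error_def chebyshev_psi_Suc)
    hence "of_real (psi_error (Suc n)) = (of_real (psi_error n) + mangoldt (Suc n) - 1 :: complex)"
      by simp
    thus ?thesis by (simp only: ring_distribs) (simp add: algebra_simps)
  qed
  show ?thesis using sums_add[OF 2 1] by (simp only: eq add_0)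
qed

text \<open>
  The continuation of \<open>(psi_correction s + L s - zeta s) / s\<close>, where \<open>L\<close> is the von Mangoldt series. The
  poles of \<open>L\<close> and of zeta at \<open>1\<close> cancel: in terms of \<open>Z s = (s - 1) * zeta s\<close>, the difference \<open>L s - zeta s\<close>
  is \<open>- deriv Z s / Z s - (Z s - Z 1) / (s - 1)\<close>.
\<close>
definition psi_transform :: "complex \<Rightarrow> complex" where
  "psi_transform s = (psi_correction s - deriv pole_free_zeta s / pole_free_zeta s -
     (if s = 1 then deriv pole_free_zeta 1 else (pole_free_zeta s - pole_free_zeta 1) / (s - 1))) / s"

lemma psi_transform_sums:
  assumes s: "Re s > 1"
  shows "(\<lambda>n. of_real (psi_error n) * of_nat n powr (- s - 1)) sums psi_transform s"
proof -
  let ?\<zeta> = "\<Sum>n. of_nat n powr (- s) :: complex"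
  have s1: "s \<noteq> 0" "s \<noteq> 1" using s by auto
  have Z0: "pole_free_zeta s \<noteq> 0" using s by (intro pole_free_zeta_nonzero) auto
  have gen: "p * (s * x - y + z) + p * (y - z) = s * (p * x)" for p x y z :: complex
    by (simp add: algebra_simps)
  have shift: "s + 1 - 1 = s" "- (s + 1) = - s - 1" "1 - (s + 1) = - s" by simp_all
  have eq: "of_real (psi_error n) * zeta_term n (s + 1) + of_real (psi_error n) * (of_nat n powr (-s) - of_nat (Suc n) powr (-s))
              = s * (of_real (psi_error n) * of_nat n powr (- s - 1))" for n
    unfolding zeta_term_def shift by (rule gen)
  have "(\<lambda>n. of_real (psi_error n) * zeta_term n (s + 1)) sums psi_correction s"
    unfolding psi_correction_def using s by (intro summable_sums summable_psi_correction) auto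
  from sums_divide[OF sums_add[OF this psi_error_sums_by_parts[OF s], unfolded eq], of s]
  have "(\<lambda>n. of_real (psi_error n) * of_nat n powr (- s - 1)) sums ((psi_correction s + (mangoldt_series s - ?\<zeta>)) / s)"
    using s1(1) by (simp only: nonzero_mult_div_cancel_left not_False_eq_True)
  also have "mangoldt_series s = 1 / (s - 1) - deriv pole_free_zeta s / pole_free_zeta s"
    using deriv_pole_free_zeta[OF s] Z0 by simp
  also have "?\<zeta> = pole_free_zeta s / (s - 1)"
    using pole_free_zeta_eq[OF s] s1 by simp
  also have "(psi_correction s + (1 / (s - 1) - deriv pole_free_zeta s / pole_free_zeta s - pole_free_zeta s / (s - 1))) / s
               = psi_transform s"
  proof -
    have "(pole_free_zeta s - pole_free_zeta 1) / (s - 1) = pole_free_zeta s / (s - 1) - 1 / (s - 1)"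
      by (simp add: pole_free_zeta_1 diff_divide_distrib)
    moreover have "a + (r - d - z) = a - d - (z - r)" for a d r z :: complex by simp
    ultimately show ?thesis unfolding psi_transform_def if_not_P[OF s1(2)] by (simp only:)
  qed
  finally show ?thesis .
qed

lemma psi_transform_holomorphic: "psi_transform holomorphic_on ({s. Re s > 0} \<inter> {s. pole_free_zeta s \<noteq> 0})"
  and open_psi_transform_domain: "open ({s. Re s > 0} \<inter> {s. pole_free_zeta s \<noteq> 0})"
proof -
  let ?S = "{s. Re s > 0}" and ?U = "{s. Re s > 0} \<inter> {s. pole_free_zeta s \<noteq> 0}"
  have opn: "open ?S" by (rule open_halfspace_Re_gt)
  have "continuous_on ?S pole_free_zeta"
    by (rule holomorphic_on_imp_continuous_on[OF pole_free_zeta_holomorphic])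
  hence "open (?S \<inter> pole_free_zeta -` (- {0}))"
    by (rule continuous_open_preimage) (use opn in auto)
  also have "?S \<inter> pole_free_zeta -` (- {0}) = ?U" by auto
  finally show "open ?U" .
  have hol: "pole_free_zeta holomorphic_on ?U" "deriv pole_free_zeta holomorphic_on ?U" "psi_correction holomorphic_on ?U"
    "(\<lambda>s. if s = 1 then deriv pole_free_zeta 1 else (pole_free_zeta s - pole_free_zeta 1) / (s - 1)) holomorphic_on ?U"
    by (rule holomorphic_on_subset[of _ ?S], intro pole_free_zeta_holomorphic psi_correction_holomorphic
            pole_lemma_open holomorphic_deriv opn, blast)+
  show "psi_transform holomorphic_on ?U"
    unfolding psi_transform_def by (intro holomorphic_on_divide holomorphic_on_diff hol holomorphic_on_ident) auto
qed

text \<open>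
  Newman's theorem with \<open>a n = (psi n - n) / n\<close>; its variable \<open>z\<close> is \<open>s - 1\<close>.
\<close>
lemma convergent_psi_error_series: "convergent (\<lambda>N. \<Sum>n=1..N. psi_error n / (real n)\<^sup>2)"
proof -
  let ?U = "{s. Re s > 0} \<inter> {s. pole_free_zeta s \<noteq> 0}"
  let ?a = "\<lambda>n. complex_of_real (psi_error n / real n)"
  have "(\<lambda>N. \<Sum>n=1..N. ?a n * of_nat n powr (-1)) \<longlonglongrightarrow> (\<lambda>z. psi_transform (z + 1)) 0"
  proof (rule newman_tauberian)
    show "norm (?a n) \<le> 4" for n
      using abs_psi_error_le[of n] by (cases "n = 0") (auto simp: norm_divide divide_le_eq)
    show "open ((\<lambda>z. z + 1) -` ?U)"
      by (intro continuous_open_vimage open_psi_transform_domain continuous_intros)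
    show "{z. 0 \<le> Re z} \<subseteq> (\<lambda>z. z + 1) -` ?U"
      using pole_free_zeta_nonzero by auto
    show "(\<lambda>z. psi_transform (z + 1)) holomorphic_on (\<lambda>z. z + 1) -` ?U"
      by (rule holomorphic_on_compose_gen[OF _ psi_transform_holomorphic, unfolded o_def])
         (auto intro!: holomorphic_intros)
  next
    fix z :: complex assume z: "Re z > 0"
    have "?a n * of_nat n powr (-z-1) = of_real (psi_error n) * of_nat n powr (- (z + 1) - 1)" for n
    proof (cases "n = 0")
      case False
      have "of_nat n powr (- (z + 1) - 1) = (of_nat n powr (-z-1) / of_nat n :: complex)"
        using False powr_diff[of "of_nat n :: complex" "-z-1" 1] by (simp add: algebra_simps)
      thus ?thesis by simp
    qed simp
    thus "(\<lambda>n. ?a n * of_nat n powr (-z-1)) sums psi_transform (z + 1)"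
      using psi_transform_sums[of "z + 1"] z by simp
  qed
  from tendsto_Re[OF this]
  have "(\<lambda>N. \<Sum>n=1..N. Re (?a n * of_nat n powr (-1))) \<longlonglongrightarrow> Re (psi_transform 1)"
    by simp
  moreover have "Re (?a n * of_nat n powr (-1)) = psi_error n / (real n)\<^sup>2" for n
    by (cases "n = 0") (auto simp: powr_minus power2_eq_square field_simps)
  ultimately show ?thesis by (auto simp: convergent_def)
qed

section \<open>The prime number theorem\<close>

text \<open>
  If \<open>f N\<close> exceeds \<open>(1 + 2 * \<eta>) * N\<close>, then by monotonicity \<open>f n - n\<close> stays above \<open>\<eta> * N\<close> for all \<open>n\<close> between \<open>N\<close>
  and \<open>(1 + \<eta>) * N\<close>, so this block of the series is bounded below by a positive constant that depends on
  \<open>\<eta>\<close> only, against Cauchy's criterion. If \<open>f N\<close> is below \<open>(1 - 2 * \<eta>) * N\<close>, the block from \<open>(1 - \<eta>) * N\<close> to \<open>N\<close>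
  is used instead.
\<close>
lemma mono_tendsto_of_convergent:
  fixes f :: "nat \<Rightarrow> real"
  assumes mono: "mono f" and conv: "convergent (\<lambda>N. \<Sum>n=1..N. (f n - real n) / (real n)\<^sup>2)"
  shows "(\<lambda>n. f n / real n) \<longlonglongrightarrow> 1"
proof -
  define S where "S = (\<lambda>N. \<Sum>n=1..N. (f n - real n) / (real n)\<^sup>2)"
  have S_diff: "S N - S M = (\<Sum>n\<in>{M<..N}. (f n - real n) / (real n)\<^sup>2)" if "M \<le> N" for M N
  proof -
    have "S N - S M = (\<Sum>n\<in>{1..N}-{1..M}. (f n - real n) / (real n)\<^sup>2)"
      unfolding S_def using that by (subst sum_diff) auto
    also have "{1..N} - {1..M} = {M<..N}" by auto
    finally show ?thesis .
  qed
  have cauchy: "\<exists>N0. \<forall>m\<ge>N0. \<forall>n\<ge>N0. \<bar>S m - S n\<bar> < e" if "e > 0" for e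
    using CauchyD[OF convergent_Cauchy[OF conv], of e] that by (simp add: S_def)
  have upper: "\<forall>\<^sub>F N in sequentially. f N \<le> (1 + 2 * \<eta>) * real N" if \<eta>: "\<eta> > 0" for \<eta>
  proof -
    define e where "e = \<eta>\<^sup>2 / (2 * (1 + \<eta>)\<^sup>2)"
    have "e > 0" using \<eta> by (simp add: e_def)
    then obtain N0 where N0: "\<And>m n. m \<ge> N0 \<Longrightarrow> n \<ge> N0 \<Longrightarrow> \<bar>S m - S n\<bar> < e"
      using cauchy by blast
    have "f N \<le> (1 + 2 * \<eta>) * real N" if N: "N \<ge> N0" "N > 0" "real N \<ge> 2 / \<eta>" for N
    proof (rule ccontr)
      assume "\<not> ?thesis"
      hence big: "f N > (1 + 2 * \<eta>) * real N" by simp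
      define M where "M = nat \<lfloor>(1 + \<eta>) * real N\<rfloor>"
      have M_le: "real M \<le> (1 + \<eta>) * real N" using \<eta> by (simp add: M_def)
      have M_ge: "real M \<ge> (1 + \<eta>) * real N - 1" unfolding M_def using \<eta> by linarith
      have "\<eta> * real N \<ge> 2" using N(3) \<eta> by (simp add: field_simps)
      hence NM: "N \<le> M" using M_ge by (simp add: algebra_simps)
      have "e \<le> (real M - real N) * (\<eta> / ((1 + \<eta>)\<^sup>2 * real N))"
      proof -
        have "real M - real N \<ge> \<eta> * real N / 2" using M_ge \<open>\<eta> * real N \<ge> 2\<close> by (simp add: algebra_simps)
        hence "(real M - real N) * (\<eta> / ((1 + \<eta>)\<^sup>2 * real N)) \<ge> (\<eta> * real N / 2) * (\<eta> / ((1 + \<eta>)\<^sup>2 * real N))"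
          using \<eta> by (intro mult_right_mono) auto
        also have "(\<eta> * real N / 2) * (\<eta> / ((1 + \<eta>)\<^sup>2 * real N)) = e"
          using N by (simp add: e_def power2_eq_square)
        finally show ?thesis .
      qed
      also have "\<dots> = (\<Sum>n\<in>{N<..M}. \<eta> / ((1 + \<eta>)\<^sup>2 * real N))"
        using NM by (simp add: of_nat_diff)
      also have "\<dots> \<le> (\<Sum>n\<in>{N<..M}. (f n - real n) / (real n)\<^sup>2)"
      proof (rule sum_mono)
        fix n assume n: "n \<in> {N<..M}"
        have n_le: "real n \<le> (1 + \<eta>) * real N" using n M_le by (auto intro: order_trans[of _ "real M"])
        have "f n \<ge> f N" using n by (intro monoD[OF mono]) auto
        hence "f n - real n \<ge> \<eta> * real N" using big n_le by (simp add: algebra_simps)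
        moreover from this have "0 \<le> f n - real n" using \<eta> mult_nonneg_nonneg[of \<eta> "real N"] by linarith
        moreover have "(real n)\<^sup>2 \<le> ((1 + \<eta>) * real N)\<^sup>2" using n_le by (intro power_mono) auto
        ultimately have "\<eta> * real N / ((1 + \<eta>) * real N)\<^sup>2 \<le> (f n - real n) / (real n)\<^sup>2"
          using n \<eta> N by (intro frac_le) auto
        also have "\<eta> * real N / ((1 + \<eta>) * real N)\<^sup>2 = \<eta> / ((1 + \<eta>)\<^sup>2 * real N)"
          using N by (simp add: power2_eq_square)
        finally show "\<eta> / ((1 + \<eta>)\<^sup>2 * real N) \<le> (f n - real n) / (real n)\<^sup>2" .
      qed
      also have "\<dots> = S M - S N" using S_diff[OF NM] by simp
      finally show False using N0[of M N] N NM by auto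
    qed
    moreover have "\<forall>\<^sub>F N in sequentially. N \<ge> N0 \<and> N > 0 \<and> real N \<ge> 2 / \<eta>"
      by (intro eventually_conj eventually_ge_at_top eventually_gt_at_top
             eventually_compose_filterlim[OF _ filterlim_real_sequentially])
    ultimately show ?thesis by (auto elim: eventually_mono)
  qed
  have lower: "\<forall>\<^sub>F N in sequentially. f N \<ge> (1 - 2 * \<eta>) * real N" if \<eta>: "\<eta> > 0" "\<eta> < 1/2" for \<eta>
  proof -
    define e where "e = \<eta>\<^sup>2 / 2"
    have "e > 0" using \<eta> by (simp add: e_def)
    then obtain N0 where N0: "\<And>m n. m \<ge> N0 \<Longrightarrow> n \<ge> N0 \<Longrightarrow> \<bar>S m - S n\<bar> < e"
      using cauchy by blast
    have "f N \<ge> (1 - 2 * \<eta>) * real N" if N: "N \<ge> 2 * N0" "N > 0" "real N \<ge> 2 / \<eta>" for N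
    proof (rule ccontr)
      assume "\<not> ?thesis"
      hence small: "f N < (1 - 2 * \<eta>) * real N" by simp
      define M where "M = nat \<lceil>(1 - \<eta>) * real N\<rceil>"
      have M_ge: "real M \<ge> (1 - \<eta>) * real N" unfolding M_def by linarith
      have M_le: "real M \<le> (1 - \<eta>) * real N + 1"
      proof -
        have "(1 - \<eta>) * real N \<ge> 0" using \<eta> by (intro mult_nonneg_nonneg) auto
        hence "\<lceil>(1 - \<eta>) * real N\<rceil> \<ge> 0" by linarith
        hence "real M = of_int \<lceil>(1 - \<eta>) * real N\<rceil>" by (simp add: M_def)
        thus ?thesis by linarith
      qed
      have \<eta>N: "\<eta> * real N \<ge> 2" using N(3) \<eta> by (simp add: field_simps)
      have NM: "M \<le> N" using M_le \<eta>N by (simp add: algebra_simps)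
      have "\<eta> * real N \<le> 1 / 2 * real N" using \<eta> by (intro mult_right_mono) auto
      hence "real N \<le> 2 * real M" using M_ge by (simp add: algebra_simps)
      hence MN0: "M \<ge> N0" using N by linarith
      have "S N - S M = (\<Sum>n\<in>{M<..N}. (f n - real n) / (real n)\<^sup>2)" by (rule S_diff[OF NM])
      also have "\<dots> \<le> (\<Sum>n\<in>{M<..N}. - \<eta> / real N)"
      proof (rule sum_mono)
        fix n assume n: "n \<in> {M<..N}"
        have n_ge: "real n \<ge> (1 - \<eta>) * real N" using n M_ge by (auto intro: order_trans[of _ "real M"])
        have "f n \<le> f N" using n by (intro monoD[OF mono]) auto
        hence "real n - f n \<ge> \<eta> * real N" using small n_ge by (simp add: algebra_simps)
        moreover from this have "0 \<le> real n - f n" using \<eta> mult_nonneg_nonneg[of \<eta> "real N"] by linarith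
        moreover have "(real n)\<^sup>2 \<le> (real N)\<^sup>2" using n by (intro power_mono) auto
        ultimately have "\<eta> * real N / (real N)\<^sup>2 \<le> (real n - f n) / (real n)\<^sup>2"
          using n \<eta> N by (intro frac_le) auto
        also have "\<eta> * real N / (real N)\<^sup>2 = \<eta> / real N"
          using N by (simp add: power2_eq_square)
        finally show "(f n - real n) / (real n)\<^sup>2 \<le> - \<eta> / real N"
          by (simp add: diff_divide_distrib)
      qed
      also have "\<dots> = - ((real N - real M) * (\<eta> / real N))"
        using NM by (simp add: of_nat_diff)
      also have "\<dots> \<le> - e"
      proof -
        have "real N - real M \<ge> \<eta> * real N / 2" using M_le \<eta>N by (simp add: algebra_simps)
        hence "(real N - real M) * (\<eta> / real N) \<ge> (\<eta> * real N / 2) * (\<eta> / real N)"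
          using \<eta> by (intro mult_right_mono) auto
        also have "(\<eta> * real N / 2) * (\<eta> / real N) = e"
          using N by (simp add: e_def power2_eq_square)
        finally show ?thesis by simp
      qed
      finally show False using N0[of N M] N MN0 by auto
    qed
    moreover have "\<forall>\<^sub>F N in sequentially. N \<ge> 2 * N0 \<and> N > 0 \<and> real N \<ge> 2 / \<eta>"
      by (intro eventually_conj eventually_ge_at_top eventually_gt_at_top
             eventually_compose_filterlim[OF _ filterlim_real_sequentially])
    ultimately show ?thesis by (auto elim: eventually_mono)
  qed
  show ?thesis
  proof (rule tendstoI)
    fix e :: real assume e: "e > 0"
    define \<eta> where "\<eta> = min (e / 3) (1 / 3)"
    have \<eta>: "\<eta> > 0" "\<eta> < 1 / 2" "2 * \<eta> < e" using e by (auto simp: \<eta>_def min_def)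
    show "\<forall>\<^sub>F n in sequentially. dist (f n / real n) 1 < e"
      using upper[OF \<eta>(1)] lower[OF \<eta>(1,2)] eventually_gt_at_top[of 0]
    proof eventually_elim
      case (elim n)
      have "f n / real n \<le> 1 + 2 * \<eta>" "f n / real n \<ge> 1 - 2 * \<eta>"
        using elim by (auto simp: field_simps)
      thus ?case using \<eta> by (auto simp: dist_real_def abs_less_iff)
    qed
  qed
qed

theorem chebyshev_psi_asymptotics: "(\<lambda>n. chebyshev_psi n / real n) \<longlonglongrightarrow> 1"
proof (rule mono_tendsto_of_convergent)
  show "mono chebyshev_psi" by (intro monoI chebyshev_psi_mono)
  show "convergent (\<lambda>N. \<Sum>n=1..N. (chebyshev_psi n - real n) / (real n)\<^sup>2)"
    using convergent_psi_error_series by (simp add: psi_error_def)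
qed

section \<open>The sum of the primes up to a bound\<close>

definition primes_upto :: "nat \<Rightarrow> nat set" where
  "primes_upto n = {p. prime p \<and> p \<le> n}"

lemma finite_primes_upto [simp, intro]: "finite (primes_upto n)"
  unfolding primes_upto_def by (rule finite_subset[of _ "{..n}"]) auto

definition chebyshev_theta :: "nat \<Rightarrow> real" where
  "chebyshev_theta n = (\<Sum>p\<in>primes_upto n. ln (real p))"

text \<open>
  A prime power \<open>p ^ k \<le> n\<close> with \<open>k \<ge> 2\<close> has \<open>p \<le> sqrt n\<close> and \<open>k \<le> log 2 n\<close>, so there are few of them, each
  with weight at most \<open>ln n\<close>.
\<close>
lemma chebyshev_psi_minus_theta:
  assumes n: "n > 0"
  shows "chebyshev_theta n \<le> chebyshev_psi n"
    and "chebyshev_psi n - chebyshev_theta n \<le> (sqrt (real n) + 1) * (log 2 (real n) + 1) * ln (real n)"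
proof -
  let ?A = "{d\<in>{1..n}. primepow d \<and> \<not>prime d}"
  define s where "s = nat \<lfloor>sqrt (real n)\<rfloor>"
  define l where "l = nat \<lfloor>log 2 (real n)\<rfloor>"
  have sub: "primes_upto n \<subseteq> {1..n}"
    by (auto simp: primes_upto_def Suc_le_eq prime_gt_0_nat)
  have "chebyshev_psi n = (\<Sum>d\<in>{1..n}-primes_upto n. mangoldt d) + (\<Sum>d\<in>primes_upto n. mangoldt d)"
    unfolding chebyshev_psi_def by (rule sum.subset_diff[OF sub]) auto
  also have "(\<Sum>d\<in>primes_upto n. mangoldt d) = chebyshev_theta n"
    unfolding chebyshev_theta_def by (intro sum.cong) (auto simp: primes_upto_def)
  also have "(\<Sum>d\<in>{1..n}-primes_upto n. mangoldt d) = (\<Sum>d\<in>?A. mangoldt d :: real)"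
    by (rule sum.mono_neutral_right) (auto simp: primes_upto_def mangoldt_def)
  finally have eq: "chebyshev_psi n - chebyshev_theta n = (\<Sum>d\<in>?A. mangoldt d)" by simp
  have "(\<Sum>d\<in>?A. mangoldt d :: real) \<ge> 0"
    by (intro sum_nonneg mangoldt_nonneg)
  thus "chebyshev_theta n \<le> chebyshev_psi n" using eq by simp
  have A_sub: "?A \<subseteq> (\<lambda>(p, k). p ^ k) ` ({1..s} \<times> {1..l})"
  proof
    fix d assume d: "d \<in> ?A"
    then obtain p k where pk: "prime p" "k > 0" "d = p ^ k" by (auto simp: primepow_def)
    have p2: "p \<ge> 2" using pk by (simp add: prime_ge_2_nat)
    have "k \<noteq> 1" using d pk by auto
    hence k2: "k \<ge> 2" using pk by simp
    have "p ^ 2 \<le> p ^ k" using k2 p2 by (intro power_increasing) auto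
    hence "p ^ 2 \<le> n" using d pk by simp
    hence "real p ^ 2 \<le> real n" by (metis of_nat_le_iff of_nat_power)
    hence "real p \<le> sqrt (real n)" by (rule real_le_rsqrt)
    hence "p \<le> s" unfolding s_def by (simp add: le_nat_floor)
    moreover have "2 ^ k \<le> p ^ k" using p2 by (intro power_mono) auto
    from order_trans[OF this, of n] have "2 ^ k \<le> n" using d pk by simp
    hence "2 ^ k \<le> real n" by (metis of_nat_le_iff of_nat_numeral of_nat_power)
    hence "real k \<le> log 2 (real n)" using n by (subst le_log_iff) (auto simp: powr_realpow)
    hence "k \<le> l" unfolding l_def by (simp add: le_nat_floor)
    ultimately show "d \<in> (\<lambda>(p, k). p ^ k) ` ({1..s} \<times> {1..l})"
      using pk p2 by (auto intro!: image_eqI[of _ _ "(p, k)"])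
  qed
  have "card ?A \<le> card ({1..s} \<times> {1..l})"
    by (rule surj_card_le[OF _ A_sub]) auto
  hence "real (card ?A) \<le> real s * real l"
    by (metis card_atLeastAtMost card_cartesian_product diff_Suc_1 of_nat_le_iff of_nat_mult)
  also have "\<dots> \<le> sqrt (real n) * log 2 (real n)"
    unfolding s_def l_def using n by (intro mult_mono) (auto simp: of_nat_floor)
  also have "\<dots> \<le> (sqrt (real n) + 1) * (log 2 (real n) + 1)"
    using n by (intro mult_mono) auto
  finally have card: "real (card ?A) \<le> (sqrt (real n) + 1) * (log 2 (real n) + 1)" .
  have "(\<Sum>d\<in>?A. mangoldt d) \<le> (\<Sum>d\<in>?A. ln (real n))"
  proof (rule sum_mono)
    fix d assume d: "d \<in> ?A"
    hence "mangoldt d \<le> ln (real d)" by (intro mangoldt_le) auto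
    also have "\<dots> \<le> ln (real n)" using d by (subst ln_le_cancel_iff) auto
    finally show "mangoldt d \<le> ln (real n)" .
  qed
  also have "\<dots> = real (card ?A) * ln (real n)" by simp
  also have "\<dots> \<le> (sqrt (real n) + 1) * (log 2 (real n) + 1) * ln (real n)"
    using card n by (intro mult_right_mono) auto
  finally show "chebyshev_psi n - chebyshev_theta n \<le> (sqrt (real n) + 1) * (log 2 (real n) + 1) * ln (real n)"
    using eq by simp
qed

lemma chebyshev_theta_asymptotics: "(\<lambda>n. chebyshev_theta n / real n) \<longlonglongrightarrow> 1"
proof -
  have "(\<lambda>n. (chebyshev_psi n - chebyshev_theta n) / real n) \<longlonglongrightarrow> 0"
  proof (rule tendsto_sandwich)
    show "\<forall>\<^sub>F n in sequentially. 0 \<le> (chebyshev_psi n - chebyshev_theta n) / real n"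
      using eventually_gt_at_top[of 0]
      by eventually_elim (use chebyshev_psi_minus_theta(1) in auto)
    show "\<forall>\<^sub>F n in sequentially. (chebyshev_psi n - chebyshev_theta n) / real n \<le>
             (sqrt (real n) + 1) * (log 2 (real n) + 1) * ln (real n) / real n"
      using eventually_gt_at_top[of 0]
      by eventually_elim (use chebyshev_psi_minus_theta(2) in \<open>auto intro!: divide_right_mono\<close>)
    show "(\<lambda>n. (sqrt (real n) + 1) * (log 2 (real n) + 1) * ln (real n) / real n) \<longlonglongrightarrow> 0"
      by real_asymp
  qed auto
  from tendsto_diff[OF chebyshev_psi_asymptotics this] show ?thesis
    by (simp add: diff_divide_distrib)
qed

text \<open>
  The deviation \<open>f k - k\<close> is at most \<open>C + e * k\<close> for every positive \<open>e\<close>, with \<open>C\<close> depending on \<open>e\<close>; summing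
  gives \<open>C * n + e * n\<^sup>2 / 2\<close>.
\<close>
lemma sum_tendsto_half:
  fixes f :: "nat \<Rightarrow> real"
  assumes f: "(\<lambda>n. f n / real n) \<longlonglongrightarrow> 1"
  shows "(\<lambda>n. (\<Sum>k<n. f k) / (real n)\<^sup>2) \<longlonglongrightarrow> 1 / 2"
proof -
  have gauss: "(\<Sum>k<n. real k) = real n * (real n - 1) / 2" for n
    by (induction n) (auto simp: field_simps)
  have "(\<lambda>n. (\<Sum>k<n. f k - real k) / (real n)\<^sup>2) \<longlonglongrightarrow> 0"
  proof (rule tendstoI)
    fix e :: real assume e: "e > 0"
    have "\<forall>\<^sub>F n in sequentially. dist (f n / real n) 1 < e" using f e by (rule tendstoD)
    then obtain N where N: "\<And>n. n \<ge> N \<Longrightarrow> dist (f n / real n) 1 < e"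
      by (auto simp: eventually_at_top_linorder)
    define C where "C = (\<Sum>k\<le>N. \<bar>f k - real k\<bar>)"
    have bound: "\<bar>f k - real k\<bar> \<le> C + e * real k" for k
    proof (cases "k \<le> N")
      case True
      hence "\<bar>f k - real k\<bar> \<le> C" unfolding C_def by (intro member_le_sum) auto
      thus ?thesis using e by (simp add: add_increasing2)
    next
      case False
      hence "\<bar>f k / real k - 1\<bar> < e" using N[of k] by (simp add: dist_real_def)
      moreover have "f k / real k - 1 = (f k - real k) / real k" using False by (simp add: field_simps)
      ultimately have "\<bar>f k - real k\<bar> \<le> e * real k" using False by (simp add: divide_less_eq)
      moreover have "C \<ge> 0" unfolding C_def by (intro sum_nonneg) auto
      ultimately show ?thesis by simp
    qed
    have "\<bar>(\<Sum>k<n. f k - real k)\<bar> \<le> C * real n + e / 2 * (real n)\<^sup>2" for n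
    proof -
      have "\<bar>(\<Sum>k<n. f k - real k)\<bar> \<le> (\<Sum>k<n. C + e * real k)"
        by (intro order_trans[OF sum_abs] sum_mono bound)
      also have "\<dots> = C * real n + e * (\<Sum>k<n. real k)"
        by (simp add: sum.distrib sum_distrib_left)
      also have "\<dots> \<le> C * real n + e / 2 * (real n)\<^sup>2"
        unfolding gauss using e by (simp add: field_simps power2_eq_square)
      finally show ?thesis .
    qed
    note le = this
    have "(\<lambda>n. (C * real n + e / 2 * (real n)\<^sup>2) / (real n)\<^sup>2) \<longlonglongrightarrow> e / 2"
      by real_asymp
    hence "\<forall>\<^sub>F n in sequentially. (C * real n + e / 2 * (real n)\<^sup>2) / (real n)\<^sup>2 < e"
      by (rule order_tendstoD(2)) (use e in simp)
    thus "\<forall>\<^sub>F n in sequentially. dist ((\<Sum>k<n. f k - real k) / (real n)\<^sup>2) 0 < e"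
    proof eventually_elim
      case (elim n)
      have "dist ((\<Sum>k<n. f k - real k) / (real n)\<^sup>2) 0 = \<bar>(\<Sum>k<n. f k - real k)\<bar> / (real n)\<^sup>2"
        by (simp add: dist_real_def abs_divide)
      also have "\<dots> \<le> (C * real n + e / 2 * (real n)\<^sup>2) / (real n)\<^sup>2"
        by (intro divide_right_mono le) auto
      finally show ?case using elim by linarith
    qed
  qed
  moreover have "(\<lambda>n. (\<Sum>k<n. real k) / (real n)\<^sup>2) \<longlonglongrightarrow> 1 / 2"
    unfolding gauss by real_asymp
  ultimately have "(\<lambda>n. (\<Sum>k<n. f k - real k) / (real n)\<^sup>2 + (\<Sum>k<n. real k) / (real n)\<^sup>2) \<longlonglongrightarrow> 0 + 1 / 2"
    by (rule tendsto_add)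
  thus ?thesis by (simp add: sum_subtractf diff_divide_distrib)
qed

lemma primes_upto_Suc: "primes_upto (Suc n) = (if prime (Suc n) then insert (Suc n) (primes_upto n) else primes_upto n)"
  by (auto simp: primes_upto_def le_Suc_eq)

lemma Suc_notin_primes_upto [simp]: "Suc n \<notin> primes_upto n"
  by (auto simp: primes_upto_def)

lemma sum_p_ln_p_by_parts:
  "(\<Sum>p\<in>primes_upto n. real p * ln (real p)) = real n * chebyshev_theta n - (\<Sum>k<n. chebyshev_theta k)"
proof (induction n)
  case 0
  show ?case by (simp add: primes_upto_def)
next
  case (Suc n)
  show ?case using Suc by (auto simp: primes_upto_Suc chebyshev_theta_def algebra_simps)
qed

lemma sum_p_ln_p_asymptotics:
  "(\<lambda>n. (\<Sum>p\<in>primes_upto n. real p * ln (real p)) / (real n)\<^sup>2) \<longlonglongrightarrow> 1 / 2"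
proof -
  have "(\<lambda>n. chebyshev_theta n / real n - (\<Sum>k<n. chebyshev_theta k) / (real n)\<^sup>2) \<longlonglongrightarrow> 1 - 1 / 2"
    by (intro tendsto_diff chebyshev_theta_asymptotics sum_tendsto_half)
  moreover have "chebyshev_theta n / real n - (\<Sum>k<n. chebyshev_theta k) / (real n)\<^sup>2 =
                   (\<Sum>p\<in>primes_upto n. real p * ln (real p)) / (real n)\<^sup>2" for n
    unfolding sum_p_ln_p_by_parts by (cases "n = 0") (auto simp: diff_divide_distrib power2_eq_square)
  ultimately show ?thesis by simp
qed

definition prime_sum :: "nat \<Rightarrow> real" where
  "prime_sum n = (\<Sum>p\<in>primes_upto n. real p)"

text \<open>
  The primes up to \<open>n powr (1 - \<delta>)\<close> are estimated trivially; for the others \<open>ln p \<ge> (1 - \<delta>) * ln n\<close>.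
\<close>
lemma prime_sum_upper:
  assumes \<delta>: "0 < \<delta>" "\<delta> < 1" and n: "n > 1"
  shows "prime_sum n * ln (real n) / (real n)\<^sup>2 \<le>
     real n powr (- 2 * \<delta>) * ln (real n) + (\<Sum>p\<in>primes_upto n. real p * ln (real p)) / (real n)\<^sup>2 / (1 - \<delta>)"
proof -
  define y where "y = real n powr (1 - \<delta>)"
  have y: "y \<ge> 0" by (simp add: y_def)
  have ln_n: "ln (real n) > 0" using n by simp
  have "prime_sum n = (\<Sum>p\<in>{p\<in>primes_upto n. real p \<le> y}. real p) + (\<Sum>p\<in>{p\<in>primes_upto n. \<not>real p \<le> y}. real p)"
    unfolding prime_sum_def by (subst sum.union_disjoint [symmetric]) (auto intro!: sum.cong)
  also have "(\<Sum>p\<in>{p\<in>primes_upto n. real p \<le> y}. real p) \<le> y * y"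
  proof -
    have "(\<Sum>p\<in>{p\<in>primes_upto n. real p \<le> y}. real p) \<le> (\<Sum>p\<in>{1..nat \<lfloor>y\<rfloor>}. y)"
    proof (rule sum_le_included[where i = id])
      show "\<forall>x\<in>{p \<in> primes_upto n. real p \<le> y}. \<exists>z\<in>{1..nat \<lfloor>y\<rfloor>}. id z = x \<and> real x \<le> y"
        by (auto simp: primes_upto_def le_nat_floor Suc_le_eq prime_gt_0_nat)
    qed (use y in auto)
    also have "\<dots> = real (nat \<lfloor>y\<rfloor>) * y" by simp
    also have "\<dots> \<le> y * y" using y by (intro mult_right_mono) (auto simp: of_nat_floor)
    finally show ?thesis .
  qed
  also have "y * y = real n powr (- 2 * \<delta>) * (real n)\<^sup>2"
  proof -
    have "y * y = real n powr ((1 - \<delta>) + (1 - \<delta>))" unfolding y_def by (simp only: powr_add)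
    also have "(1 - \<delta>) + (1 - \<delta>) = - 2 * \<delta> + 2" by simp
    also have "real n powr \<dots> = real n powr (- 2 * \<delta>) * real n powr 2" by (rule powr_add)
    also have "real n powr 2 = (real n)\<^sup>2" using n by (simp add: powr_numeral)
    finally show ?thesis .
  qed
  also have "(\<Sum>p\<in>{p\<in>primes_upto n. \<not>real p \<le> y}. real p) \<le>
             (\<Sum>p\<in>primes_upto n. real p * ln (real p)) / ((1 - \<delta>) * ln (real n))"
  proof -
    have "(\<Sum>p\<in>{p\<in>primes_upto n. \<not>real p \<le> y}. real p) \<le>
            (\<Sum>p\<in>{p\<in>primes_upto n. \<not>real p \<le> y}. real p * ln (real p) / ((1 - \<delta>) * ln (real n)))"
    proof (rule sum_mono)
      fix p assume p: "p \<in> {p\<in>primes_upto n. \<not>real p \<le> y}"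
      hence p0: "p > 0" by (auto simp: primes_upto_def prime_gt_0_nat)
      have "ln y \<le> ln (real p)" using p p0 n by (subst ln_le_cancel_iff) (auto simp: y_def)
      hence "(1 - \<delta>) * ln (real n) \<le> ln (real p)" using n by (simp add: y_def ln_powr)
      hence "1 \<le> ln (real p) / ((1 - \<delta>) * ln (real n))" using ln_n \<delta> by (simp add: le_divide_eq)
      hence "real p * 1 \<le> real p * (ln (real p) / ((1 - \<delta>) * ln (real n)))" by (intro mult_left_mono) auto
      thus "real p \<le> real p * ln (real p) / ((1 - \<delta>) * ln (real n))" by simp
    qed
    also have "\<dots> \<le> (\<Sum>p\<in>primes_upto n. real p * ln (real p) / ((1 - \<delta>) * ln (real n)))"
      using ln_n \<delta> by (intro sum_mono2) (auto simp: primes_upto_def prime_gt_0_nat Suc_le_eq intro!: divide_nonneg_nonneg mult_nonneg_nonneg)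
    finally show ?thesis by (simp add: sum_divide_distrib)
  qed
  finally have "prime_sum n \<le> real n powr (- 2 * \<delta>) * (real n)\<^sup>2 + (\<Sum>p\<in>primes_upto n. real p * ln (real p)) / ((1 - \<delta>) * ln (real n))"
    by simp
  hence "prime_sum n * (ln (real n) / (real n)\<^sup>2) \<le>
          (real n powr (- 2 * \<delta>) * (real n)\<^sup>2 + (\<Sum>p\<in>primes_upto n. real p * ln (real p)) / ((1 - \<delta>) * ln (real n))) * (ln (real n) / (real n)\<^sup>2)"
    using ln_n by (intro mult_right_mono) auto
  also have "\<dots> = real n powr (- 2 * \<delta>) * ln (real n) + (\<Sum>p\<in>primes_upto n. real p * ln (real p)) / (real n)\<^sup>2 / (1 - \<delta>)"
    using ln_n n \<delta> by (simp add: field_simps)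
  finally show ?thesis by simp
qed

lemma prime_sum_lower:
  "(\<Sum>p\<in>primes_upto n. real p * ln (real p)) \<le> prime_sum n * ln (real n)"
  unfolding prime_sum_def sum_distrib_right
  by (intro sum_mono mult_left_mono ln_mono) (auto simp: primes_upto_def prime_gt_0_nat)

lemma prime_sum_asymptotics: "(\<lambda>n. prime_sum n * ln (real n) / (real n)\<^sup>2) \<longlonglongrightarrow> 1 / 2"
proof (rule order_tendstoI)
  let ?W = "\<lambda>n. (\<Sum>p\<in>primes_upto n. real p * ln (real p)) / (real n)\<^sup>2"
  {
    fix a :: real assume "a < 1 / 2"
    hence "\<forall>\<^sub>F n in sequentially. a < ?W n"
      by (rule order_tendstoD(1)[OF sum_p_ln_p_asymptotics])
    thus "\<forall>\<^sub>F n in sequentially. a < prime_sum n * ln (real n) / (real n)\<^sup>2"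
      by eventually_elim (erule less_le_trans, intro divide_right_mono prime_sum_lower, simp)
  }
  {
    fix a :: real assume a: "1 / 2 < a"
    have "\<exists>\<delta>. 0 < \<delta> \<and> \<delta> < 1 \<and> 1 / 2 / (1 - \<delta>) < a"
    proof -
      \<comment> \<open>This choice turns \<open>1 / (2 * (1 - \<delta>))\<close> into \<open>a / (a + 1 / 2)\<close>, which is below \<open>a\<close>.\<close>
      define \<delta> where "\<delta> = (a - 1 / 2) / (2 * a)"
      have "0 < \<delta>" "\<delta> < 1" using a by (auto simp: \<delta>_def field_simps)
      moreover have \<delta>': "1 - \<delta> = (a + 1 / 2) / (2 * a)" using a by (simp add: \<delta>_def field_simps)
      have "1 / 2 / (1 - \<delta>) = a / (a + 1 / 2)" unfolding \<delta>' using a by (simp add: field_simps)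
      moreover have "a / (a + 1 / 2) < a" using a by (simp add: field_simps)
      ultimately show ?thesis by (intro exI[of _ \<delta>]) auto
    qed
    then obtain \<delta> where \<delta>: "0 < \<delta>" "\<delta> < 1" "1 / 2 / (1 - \<delta>) < a" by blast
    have "(\<lambda>n. real n powr (- 2 * \<delta>) * ln (real n)) \<longlonglongrightarrow> 0" using \<delta> by real_asymp
    moreover have "(\<lambda>n. ?W n / (1 - \<delta>)) \<longlonglongrightarrow> 1 / 2 / (1 - \<delta>)"
      using \<delta> by (intro tendsto_divide sum_p_ln_p_asymptotics tendsto_const) auto
    ultimately have "(\<lambda>n. real n powr (- 2 * \<delta>) * ln (real n) + ?W n / (1 - \<delta>)) \<longlonglongrightarrow> 0 + 1 / 2 / (1 - \<delta>)"
      by (rule tendsto_add)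
    hence "\<forall>\<^sub>F n in sequentially. real n powr (- 2 * \<delta>) * ln (real n) + ?W n / (1 - \<delta>) < a"
      by (rule order_tendstoD(2)) (use \<delta> in simp)
    thus "\<forall>\<^sub>F n in sequentially. prime_sum n * ln (real n) / (real n)\<^sup>2 < a"
      using eventually_gt_at_top[of 1]
      by eventually_elim (rule le_less_trans[OF prime_sum_upper[OF \<delta>(1,2)]])
  }
qed

section \<open>Summation over the quotients of the bound\<close>

lemma prime_sum_0 [simp]: "prime_sum 0 = 0" and prime_sum_1 [simp]: "prime_sum (Suc 0) = 0"
proof -
  have "primes_upto 0 = {}" "primes_upto (Suc 0) = {}"
    by (auto simp: primes_upto_def dest: prime_gt_1_nat)
  thus "prime_sum 0 = 0" "prime_sum (Suc 0) = 0" by (simp_all add: prime_sum_def)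
qed

lemma prime_sum_nonneg: "prime_sum n \<ge> 0"
  by (simp add: prime_sum_def sum_nonneg)

text \<open>
  The summand \<open>1\<close> next to the logarithm makes the bound usable for small \<open>k\<close>, where \<open>ln k\<close> is near \<open>0\<close>; it
  costs a factor since \<open>ln k \<ge> ln 2\<close> as soon as the sum of primes is nonzero.
\<close>
lemma prime_sum_bound:
  obtains C where "C > 0" "\<And>k. prime_sum k * (1 + ln (real k)) \<le> C * (real k)\<^sup>2"
proof -
  have "Bseq (\<lambda>n. prime_sum n * ln (real n) / (real n)\<^sup>2)"
    using prime_sum_asymptotics by (intro convergent_imp_Bseq) (auto simp: convergent_def)
  then obtain K where K: "K > 0" "\<And>n. \<bar>prime_sum n * ln (real n) / (real n)\<^sup>2\<bar> \<le> K"
    by (auto elim!: BseqE)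
  have ln2: "ln (2::real) > 0" by simp
  have "prime_sum k * (1 + ln (real k)) \<le> (K / ln 2 + K) * (real k)\<^sup>2" for k
  proof (cases "k \<le> 1")
    case True
    hence "k = 0 \<or> k = 1" by auto
    thus ?thesis using K(1) by auto
  next
    case False
    have 1: "prime_sum k * ln (real k) \<le> K * (real k)\<^sup>2"
    proof -
      have "prime_sum k * ln (real k) / (real k)\<^sup>2 \<le> K" using K(2)[of k] by linarith
      thus ?thesis using False by (simp add: divide_le_eq)
    qed
    have "ln 2 \<le> ln (real k)" using False by (subst ln_le_cancel_iff) auto
    hence "prime_sum k * ln 2 \<le> prime_sum k * ln (real k)" by (intro mult_left_mono prime_sum_nonneg)
    hence "prime_sum k \<le> K * (real k)\<^sup>2 / ln 2" using 1 ln2 by (simp add: le_divide_eq)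
    thus ?thesis using 1 by (simp add: algebra_simps)
  qed
  moreover have "K / ln 2 + K > 0" using K(1) by (simp add: add_pos_pos)
  ultimately show ?thesis using that by blast
qed

lemma real_div_bounds:
  "real (N div m) \<le> real N / real m" "real N / real m - 1 \<le> real (N div m)"
proof -
  have "real (N div m) = of_int \<lfloor>real N / real m\<rfloor>"
    by (simp add: floor_divide_of_nat_eq)
  thus "real (N div m) \<le> real N / real m" "real N / real m - 1 \<le> real (N div m)"
    by linarith+
qed

text \<open>
  The domination for Tannery's theorem. With \<open>k = N div m\<close>, the inequality \<open>N \<le> 2 * k * m\<close> gives
  \<open>ln N \<le> (1 + ln k) * (1 + ln m)\<close>, and \<open>1 + ln k\<close> is absorbed by the bound for the sum of primes.
\<close>
lemma prime_sum_quotient_bound: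
  assumes C: "C > 0" "\<And>k. prime_sum k * (1 + ln (real k)) \<le> C * (real k)\<^sup>2" and m: "m > 0" and N: "N > 0"
  shows "prime_sum (N div m) * ln (real N) / (real N)\<^sup>2 \<le> C * (1 + ln (real m)) / (real m)\<^sup>2"
proof (cases "N div m = 0")
  case True
  thus ?thesis using C m by simp
next
  case False
  define k where "k = N div m"
  have k: "k > 0" using False by (simp add: k_def)
  have "N < m * (k + 1)" unfolding k_def by (metis dividend_less_times_div m add.commute mult_Suc_right Suc_eq_plus1)
  also have "\<dots> \<le> m * (2 * k)" using k by (intro mult_left_mono) auto
  finally have "real N \<le> real (m * (2 * k))" by (intro of_nat_mono less_imp_le)
  hence "real N \<le> 2 * real k * real m" by (simp add: mult_ac)
  hence "ln (real N) \<le> ln (2 * real k * real m)" using N k m by (subst ln_le_cancel_iff) auto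
  also have "\<dots> = ln 2 + ln (real k) + ln (real m)" using k m by (simp add: ln_mult)
  also have "\<dots> \<le> 1 + ln (real k) + ln (real m)" using ln_2_less_1 by simp
  also have "\<dots> \<le> (1 + ln (real k)) * (1 + ln (real m))"
    using k m by (simp add: algebra_simps)
  finally have "prime_sum k * ln (real N) \<le> prime_sum k * ((1 + ln (real k)) * (1 + ln (real m)))"
    by (intro mult_left_mono prime_sum_nonneg)
  also have "\<dots> = (prime_sum k * (1 + ln (real k))) * (1 + ln (real m))" by simp
  also have "\<dots> \<le> (C * (real k)\<^sup>2) * (1 + ln (real m))" using m by (intro mult_right_mono C) auto
  also have "\<dots> \<le> (C * (real N / real m)\<^sup>2) * (1 + ln (real m))"
    using C m real_div_bounds(1)[of N m] by (intro mult_right_mono mult_left_mono power_mono) (auto simp: k_def)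
  finally show ?thesis using N m by (simp add: k_def field_simps power_divide)
qed

lemma div_asymptotics:
  assumes m: "m > (0::nat)"
  shows "filterlim (\<lambda>N. N div m) at_top at_top"
    and "(\<lambda>N. real (N div m) / real N) \<longlonglongrightarrow> 1 / real m"
proof -
  show "filterlim (\<lambda>N. N div m) at_top at_top"
    unfolding filterlim_at_top
  proof
    fix Z
    show "\<forall>\<^sub>F N in sequentially. Z \<le> N div m"
      using eventually_ge_at_top[of "Z * m"]
      by eventually_elim (use m in \<open>simp add: less_eq_div_iff_mult_less_eq\<close>)
  qed
  show "(\<lambda>N. real (N div m) / real N) \<longlonglongrightarrow> 1 / real m"
  proof (rule tendsto_sandwich)
    show "\<forall>\<^sub>F N in sequentially. (real N / real m - 1) / real N \<le> real (N div m) / real N"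
      by (intro always_eventually allI divide_right_mono real_div_bounds) auto
    show "\<forall>\<^sub>F N in sequentially. real (N div m) / real N \<le> (real N / real m) / real N"
      by (intro always_eventually allI divide_right_mono real_div_bounds) auto
    show "(\<lambda>N. (real N / real m - 1) / real N) \<longlonglongrightarrow> 1 / real m"
      unfolding inverse_eq_divide[symmetric] using m by real_asymp
    show "(\<lambda>N. (real N / real m) / real N) \<longlonglongrightarrow> 1 / real m"
      unfolding inverse_eq_divide[symmetric] using m by real_asymp
  qed
qed

text \<open>
  The quotient is rewritten through \<open>N div m\<close>; replacing \<open>ln (N div m)\<close> by \<open>ln N\<close> is harmless since the two
  differ by a convergent sequence.
\<close>
lemma prime_sum_quotient_limit:
  assumes m: "m > 0"
  shows "(\<lambda>N. prime_sum (N div m) * ln (real N) / (real N)\<^sup>2) \<longlonglongrightarrow> 1 / 2 / (real m)\<^sup>2"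
proof -
  let ?q = "\<lambda>N. real (N div m) / real N"
  note q = div_asymptotics[OF m]
  have 1: "(\<lambda>N. prime_sum (N div m) * ln (real (N div m)) / (real (N div m))\<^sup>2) \<longlonglongrightarrow> 1 / 2"
    by (rule filterlim_compose[OF prime_sum_asymptotics q(1)])
  have "(\<lambda>N. ln (?q N)) \<longlonglongrightarrow> ln (1 / real m)"
    using m by (intro tendsto_ln q) auto
  moreover have "filterlim (\<lambda>N. ln (real N)) at_top sequentially" by real_asymp
  ultimately have "(\<lambda>N. ln (?q N) / ln (real N)) \<longlonglongrightarrow> 0"
    by (rule tendsto_divide_0[OF _ filterlim_at_top_imp_at_infinity])
  hence "(\<lambda>N. 1 / (1 + ln (?q N) / ln (real N))) \<longlonglongrightarrow> 1 / (1 + 0)"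
    by (intro tendsto_intros) auto
  hence "(\<lambda>N. prime_sum (N div m) * ln (real (N div m)) / (real (N div m))\<^sup>2 * (?q N)\<^sup>2 * (1 / (1 + ln (?q N) / ln (real N))))
           \<longlonglongrightarrow> 1 / 2 * (1 / real m)\<^sup>2 * (1 / (1 + 0))"
    by (intro tendsto_mult tendsto_power 1 q)
  moreover have "\<forall>\<^sub>F N in sequentially. prime_sum (N div m) * ln (real (N div m)) / (real (N div m))\<^sup>2 * (?q N)\<^sup>2 * (1 / (1 + ln (?q N) / ln (real N)))
                   = prime_sum (N div m) * ln (real N) / (real N)\<^sup>2"
    using eventually_gt_at_top[of 1] eventually_compose_filterlim[OF eventually_gt_at_top[of 1] q(1)]
  proof eventually_elim
    case (elim N)
    have "1 + ln (?q N) / ln (real N) = ln (real (N div m)) / ln (real N)"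
      using elim by (simp add: ln_div field_simps)
    moreover have "ln (real (N div m)) > 0" "ln (real N) > 0" using elim by auto
    ultimately show ?case using elim by (simp add: power_divide)
  qed
  ultimately have "(\<lambda>N. prime_sum (N div m) * ln (real N) / (real N)\<^sup>2) \<longlonglongrightarrow> 1 / 2 * (1 / real m)\<^sup>2 * (1 / (1 + 0))"
    by (rule Lim_transform_eventually)
  thus ?thesis by (simp add: power_divide)
qed

lemma sum_prime_sum_quotients:
  "(\<lambda>N. (\<Sum>m=1..N. prime_sum (N div m)) * ln (real N) / (real N)\<^sup>2) \<longlonglongrightarrow> pi\<^sup>2 / 12"
proof -
  obtain C where C: "C > 0" "\<And>k. prime_sum k * (1 + ln (real k)) \<le> C * (real k)\<^sup>2"
    by (rule prime_sum_bound) (use that in blast)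
  let ?a = "\<lambda>m N. prime_sum (N div Suc m) * ln (real N) / (real N)\<^sup>2"
  let ?M = "\<lambda>m. C * (1 + ln (real (Suc m))) / (real (Suc m))\<^sup>2"
  have "summable (\<lambda>m. norm (real m powr (- 3 / 2)))"
    by (simp add: summable_real_powr_iff)
  moreover have "?M \<in> O(\<lambda>m. real m powr (- 3 / 2))" by real_asymp
  ultimately have M: "summable ?M" by (rule summable_comparison_test_bigo)
  have ev: "eventually (\<lambda>(m, N). norm (?a m N) \<le> ?M m) (at_top \<times>\<^sub>F sequentially)"
  proof (rule eventually_mono[OF eventually_prodI[OF always_eventually eventually_gt_at_top[of 0]]])
    show "\<forall>x::nat. True" by simp
    fix x :: "nat \<times> nat" assume x: "True \<and> 0 < snd x"
    thus "case x of (m, N) \<Rightarrow> norm (?a m N) \<le> ?M m"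
      using prime_sum_quotient_bound[OF C, of "Suc (fst x)" "snd x"] prime_sum_nonneg[of "snd x div Suc (fst x)"]
      by (cases x) simp
  qed
  have "(\<lambda>N. \<Sum>m. ?a m N) \<longlonglongrightarrow> (\<Sum>m. 1 / 2 / (real (Suc m))\<^sup>2)"
    by (rule conjunct2[OF conjunct2[OF tannerys_theorem[OF prime_sum_quotient_limit ev M]]]) simp_all
  also have "(\<Sum>m. 1 / 2 / (real (Suc m))\<^sup>2) = pi\<^sup>2 / 12"
    using sums_mult[OF inverse_squares_sums, of "1 / 2"] by (simp add: sums_iff add.commute)
  also have "(\<lambda>N. \<Sum>m. ?a m N) = (\<lambda>N. (\<Sum>m=1..N. prime_sum (N div m)) * ln (real N) / (real N)\<^sup>2)"
  proof
    fix N
    have "(\<Sum>m. ?a m N) = (\<Sum>m<N. ?a m N)" by (rule suminf_finite) auto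
    also have "\<dots> = (\<Sum>m=1..N. prime_sum (N div m) * ln (real N) / (real N)\<^sup>2)"
      by (rule sum.reindex_bij_witness[of _ "\<lambda>m. m - 1" Suc]) auto
    finally show "(\<Sum>m. ?a m N) = (\<Sum>m=1..N. prime_sum (N div m)) * ln (real N) / (real N)\<^sup>2"
      by (simp add: sum_distrib_right sum_divide_distrib)
  qed
  finally show ?thesis .
qed

section \<open>The sum of prime factors\<close>

text \<open>
  Both sides sum \<open>p\<close> over the pairs of a prime \<open>p\<close> and a cofactor \<open>m\<close> with \<open>m * p \<le> N\<close>.
\<close>
lemma sum_distinct_prime_factors:
  "(\<Sum>n=1..N. \<Sum>p\<in>prime_factors n. real p) = (\<Sum>m=1..N. prime_sum (N div m))"
proof -
  have "(\<Sum>n=1..N. \<Sum>p\<in>prime_factors n. real p) = (\<Sum>(n, p)\<in>(SIGMA n:{1..N}. prime_factors n). real p)"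
    by (rule sum.Sigma) auto
  also have "\<dots> = (\<Sum>(m, p)\<in>(SIGMA m:{1..N}. primes_upto (N div m)). real p)"
  proof (rule sum.reindex_bij_witness[of _ "\<lambda>(m, p). (m * p, p)" "\<lambda>(n, p). (n div p, p)"], goal_cases)
    case (2 x)
    then obtain n p where x: "x = (n, p)" "n \<ge> 1" "n \<le> N" "prime p" "p dvd n"
      by (auto simp: in_prime_factors_iff)
    then obtain m where m: "n = p * m" by (auto elim: dvdE)
    have p0: "p > 0" using x by (simp add: prime_gt_0_nat)
    have m0: "m > 0" using x m by (auto intro: Nat.gr0I)
    have "m \<le> N" using m p0 x by (auto intro: order_trans[of m n])
    have "p * m \<le> N" using x m by simp
    hence "p \<le> N div m" using m0 by (simp add: less_eq_div_iff_mult_less_eq)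
    thus ?case using x m m0 p0 \<open>m \<le> N\<close> by (auto simp: primes_upto_def)
  next
    case (4 y)
    then obtain m p where y: "y = (m, p)" "m \<ge> 1" "m \<le> N" "prime p" "p \<le> N div m"
      by (auto simp: primes_upto_def)
    have "p > 0" using y by (simp add: prime_gt_0_nat)
    moreover have "p * m \<le> N" using y by (simp add: less_eq_div_iff_mult_less_eq)
    ultimately show ?case using y by (auto simp: in_prime_factors_iff mult.commute)
  qed (auto simp: in_prime_factors_iff primes_upto_def dest: prime_gt_0_nat)
  also have "\<dots> = (\<Sum>m=1..N. \<Sum>p\<in>primes_upto (N div m). real p)"
    by (rule sum.Sigma [symmetric]) auto
  finally show ?thesis by (simp add: prime_sum_def)
qed

lemma sum_multiplicity_le_log:
  assumes n: "n > 0"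
  shows "real (\<Sum>p\<in>prime_factors n. multiplicity p n) \<le> log 2 (real n)"
proof -
  define k where "k = (\<Sum>p\<in>prime_factors n. multiplicity p n)"
  have "2 ^ k = (\<Prod>p\<in>prime_factors n. (2::nat) ^ multiplicity p n)"
    unfolding k_def by (rule power_sum)
  also have "\<dots> \<le> (\<Prod>p\<in>prime_factors n. p ^ multiplicity p n)"
    by (intro prod_mono conjI power_mono) (auto simp: in_prime_factors_iff prime_ge_2_nat)
  also have "\<dots> = n" using n by (intro prime_factorization_nat[symmetric])
  finally have "2 ^ k \<le> real n"
    by (metis of_nat_le_iff of_nat_numeral of_nat_power)
  hence "real k \<le> log 2 (real n)" using n by (subst le_log_iff) (auto simp: powr_realpow)
  thus ?thesis by (simp only: k_def)
qed

text \<open>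
  Only primes with \<open>p\<^sup>2\<close> dividing \<open>n\<close> contribute to the difference; these are at most \<open>sqrt n\<close>, and the
  multiplicities add up to at most \<open>log 2 n\<close>.
\<close>
lemma sopfr_bounds:
  assumes n: "n > 0"
  shows "(\<Sum>p\<in>prime_factors n. real p) \<le> real (sopfr n)"
    and "real (sopfr n) \<le> (\<Sum>p\<in>prime_factors n. real p) + sqrt (real n) * log 2 (real n)"
proof -
  have mult: "multiplicity p n \<ge> 1" if "p \<in> prime_factors n" for p
    using that n by (simp add: prime_factors_multiplicity Suc_le_eq)
  have "real p \<le> real (multiplicity p n) * real p" if "p \<in> prime_factors n" for p
    using mult_right_mono[of 1 "real (multiplicity p n)" "real p"] mult[OF that] by simp
  thus "(\<Sum>p\<in>prime_factors n. real p) \<le> real (sopfr n)"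
    unfolding sopfr_def of_nat_sum of_nat_mult by (intro sum_mono)
  have le: "real (multiplicity p n) * real p \<le> real p + sqrt (real n) * real (multiplicity p n)"
    if p: "p \<in> prime_factors n" for p
  proof (cases "multiplicity p n = 1")
    case False
    hence "2 \<le> multiplicity p n" using mult[OF p] by simp
    hence "p ^ 2 dvd n" by (rule multiplicity_dvd')
    hence "p ^ 2 \<le> n" using n by (rule dvd_imp_le)
    hence "real p ^ 2 \<le> real n" by (metis of_nat_le_iff of_nat_power)
    hence "real p \<le> sqrt (real n)" by (rule real_le_rsqrt)
    hence "real (multiplicity p n) * real p \<le> real (multiplicity p n) * sqrt (real n)"
      by (intro mult_left_mono) auto
    thus ?thesis by (simp add: mult.commute add_increasing)
  qed simp
  have "real (sopfr n) \<le> (\<Sum>p\<in>prime_factors n. real p + sqrt (real n) * real (multiplicity p n))"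
    unfolding sopfr_def of_nat_sum of_nat_mult by (intro sum_mono le)
  also have "\<dots> = (\<Sum>p\<in>prime_factors n. real p) + sqrt (real n) * real (\<Sum>p\<in>prime_factors n. multiplicity p n)"
    by (simp add: sum.distrib sum_distrib_left)
  also have "\<dots> \<le> (\<Sum>p\<in>prime_factors n. real p) + sqrt (real n) * log 2 (real n)"
    using sum_multiplicity_le_log[OF n] by (intro add_left_mono mult_left_mono) auto
  finally show "real (sopfr n) \<le> (\<Sum>p\<in>prime_factors n. real p) + sqrt (real n) * log 2 (real n)" .
qed

lemma sum_sopfr_asymptotics:
  "(\<lambda>N. (\<Sum>n=1..N. real (sopfr n)) * ln (real N) / (real N)\<^sup>2) \<longlonglongrightarrow> pi\<^sup>2 / 12"
proof (rule tendsto_sandwich)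
  let ?A = "\<lambda>N. \<Sum>m=1..N. prime_sum (N div m)"
  let ?E = "\<lambda>N. real N * (sqrt (real N) * log 2 (real N))"
  have lower: "?A N \<le> (\<Sum>n=1..N. real (sopfr n))" for N
    unfolding sum_distinct_prime_factors[symmetric] by (intro sum_mono sopfr_bounds) auto
  have upper: "(\<Sum>n=1..N. real (sopfr n)) \<le> ?A N + ?E N" for N
  proof -
    have "(\<Sum>n=1..N. real (sopfr n)) \<le> (\<Sum>n=1..N. (\<Sum>p\<in>prime_factors n. real p) + sqrt (real N) * log 2 (real N))"
    proof (rule sum_mono)
      fix n assume n: "n \<in> {1..N}"
      have "sqrt (real n) * log 2 (real n) \<le> sqrt (real N) * log 2 (real N)"
        using n by (intro mult_mono) auto
      thus "real (sopfr n) \<le> (\<Sum>p\<in>prime_factors n. real p) + sqrt (real N) * log 2 (real N)"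
        using sopfr_bounds(2)[of n] n by auto
    qed
    also have "\<dots> = ?A N + ?E N"
      using sum_distinct_prime_factors[of N] by (simp add: sum.distrib)
    finally show ?thesis .
  qed
  show "\<forall>\<^sub>F N in sequentially. ?A N * ln (real N) / (real N)\<^sup>2 \<le> (\<Sum>n=1..N. real (sopfr n)) * ln (real N) / (real N)\<^sup>2"
    using eventually_gt_at_top[of 0]
    by eventually_elim (intro divide_right_mono mult_right_mono lower; simp)
  show "\<forall>\<^sub>F N in sequentially. (\<Sum>n=1..N. real (sopfr n)) * ln (real N) / (real N)\<^sup>2 \<le>
           ?A N * ln (real N) / (real N)\<^sup>2 + ?E N * ln (real N) / (real N)\<^sup>2"
    using eventually_gt_at_top[of 0]
  proof eventually_elim
    case (elim N)
    have "(\<Sum>n=1..N. real (sopfr n)) * ln (real N) / (real N)\<^sup>2 \<le> (?A N + ?E N) * ln (real N) / (real N)\<^sup>2"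
      using elim by (intro divide_right_mono mult_right_mono upper) auto
    thus ?case by (simp only: distrib_right add_divide_distrib)
  qed
  show "(\<lambda>N. ?A N * ln (real N) / (real N)\<^sup>2) \<longlonglongrightarrow> pi\<^sup>2 / 12" by (rule sum_prime_sum_quotients)
  have "(\<lambda>N. ?E N * ln (real N) / (real N)\<^sup>2) \<longlonglongrightarrow> 0" by real_asymp
  from tendsto_add[OF sum_prime_sum_quotients this]
  show "(\<lambda>N. ?A N * ln (real N) / (real N)\<^sup>2 + ?E N * ln (real N) / (real N)\<^sup>2) \<longlonglongrightarrow> pi\<^sup>2 / 12" by simp
qed

lemma B_eq: "x \<ge> 0 \<Longrightarrow> B x = (\<Sum>n=1..nat \<lfloor>x\<rfloor>. real (sopfr n))"
  unfolding B_def by (rule sum.cong) (auto simp: le_nat_floor Suc_le_eq le_floor_iff le_nat_iff)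

theorem theorem1p1:
  shows "B \<sim>[at_top] (\<lambda>x::real. pi\<^sup>2 / 12 * (x\<^sup>2 / ln x))"
proof (rule asymp_equivI')
  let ?N = "\<lambda>x::real. nat \<lfloor>x\<rfloor>"
  let ?b = "\<lambda>N. (\<Sum>n=1..N. real (sopfr n)) * ln (real N) / (real N)\<^sup>2"
  have lim: "filterlim ?N at_top at_top"
    by (rule filterlim_compose[OF filterlim_nat_sequentially filterlim_floor_sequentially])
  have L1: "((\<lambda>x. ?b (?N x)) \<longlongrightarrow> pi\<^sup>2 / 12) at_top"
    by (rule filterlim_compose[OF sum_sopfr_asymptotics lim])
  \<comment> \<open>Passing from integers to real arguments costs a factor tending to \<open>1\<close>.\<close>
  have L2: "((\<lambda>x. (real (?N x) / x)\<^sup>2 * (ln x / ln (real (?N x)))) \<longlongrightarrow> 1) at_top"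
    by real_asymp
  have L: "((\<lambda>x. ?b (?N x) / (pi\<^sup>2 / 12) * ((real (?N x) / x)\<^sup>2 * (ln x / ln (real (?N x))))) \<longlongrightarrow>
                      (pi\<^sup>2 / 12) / (pi\<^sup>2 / 12) * 1) at_top"
    by (rule tendsto_mult[OF tendsto_divide[OF L1 tendsto_const] L2]) simp
  have cancel: "b * l / n\<^sup>2 / c * ((n / x)\<^sup>2 * (k / l)) = b / (c * (x\<^sup>2 / k))"
    if "l > 0" "n > 0" for b c k l n x :: real
    using that by (simp add: power_divide)
  have "\<forall>\<^sub>F x in at_top. ?b (?N x) / (pi\<^sup>2 / 12) * ((real (?N x) / x)\<^sup>2 * (ln x / ln (real (?N x)))) =
                   B x / (pi\<^sup>2 / 12 * (x\<^sup>2 / ln x))"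
    using eventually_ge_at_top[of 2]
  proof eventually_elim
    case (elim x)
    have N: "?N x \<ge> 2" using elim by (simp add: le_nat_floor)
    hence N2: "real (?N x) \<ge> 2" by (metis of_nat_le_iff of_nat_numeral)
    have "ln (real (?N x)) > 0" by (rule ln_gt_zero) (use N2 in linarith)
    moreover have "real (?N x) > 0" using N2 by linarith
    moreover have "(\<Sum>n=1..?N x. real (sopfr n)) = B x" by (rule B_eq [symmetric]) (use elim in simp)
    ultimately show ?case by (simp only: cancel)
  qed
  with L have "((\<lambda>x. B x / (pi\<^sup>2 / 12 * (x\<^sup>2 / ln x))) \<longlongrightarrow> (pi\<^sup>2 / 12) / (pi\<^sup>2 / 12) * 1) at_top"
    by (rule Lim_transform_eventually)
  thus "((\<lambda>x. B x / (pi\<^sup>2 / 12 * (x\<^sup>2 / ln x))) \<longlongrightarrow> 1) at_top" by simp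
qed

end
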